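(* Let $M=G/H=(\mathrm{SU}(3)/\mathrm{SU}(2))\times\mathrm{SU}(2)$, let $t_1,t_2>0$ and $0<t_3\le t_4\le t_5$ be real numbers. The 4-form $$\Phi_{t_1,\dots,t_5}:=t_1^4e^{1234}+t_1^2t_2t_3(e^{1256}-e^{3456})+t_1^2t_4t_5(e^{3478}-e^{1278})+t_1^2t_2t_4(e^{1357}+e^{2457})+t_1^2t_3t_5(e^{1368}+e^{2468})$$ $$+t_1^2t_2t_5(e^{1458}-e^{2358})+t_1^2t_3t_4(e^{2367}-e^{1467})+t_2t_3t_4t_5e^{5678}$$ defines an invariant $\mathrm{Spin}(7)$-structure on $M$ which induces the general invariant metric $$g_{t_1,\dots,t_5}=t_1^2\sum_{i=1}^4e^i\otimes e^i+t_2^2\,e^5\otimes e^5+t_3^2\,e^6\otimes e^6+t_4^2\,e^7\otimes e^7+t_5^2\,e^8\otimes e^8,$$ and it is of mixed type with Lee form $$\vartheta_{t_1,\dots,t_5}=-\frac17\left(\frac{2t_2(t_3^2+t_4^2+t_5^2)}{t_3t_4t_5}\,e^5+\frac{4\sqrt3\,t_3(2t_1^2+t_2^2)}{t_1^2t_2}\,e^6\right).$$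
   Context: Write $e^{i_1\cdots i_r}=e^{i_1}\wedge\cdots\wedge e^{i_r}$. A $\mathrm{Spin}(7)$-structure on an 8-manifold is a 4-form $\Phi$ (called admissible) such that at each point there is a basis $(f^1,\dots,f^8)$ of the cotangent space with $$\Phi=f^{1234}+f^{1256}-f^{1278}+f^{1357}+f^{1368}+f^{1458}-f^{1467}+f^{5678}+f^{3478}-f^{3456}+f^{2468}+f^{2457}-f^{2358}+f^{2367}.$$ It induces the Riemannian metric $g_\Phi$ for which such bases are orthonormal and the orientation $f^{12345678}$; $\star$ is the Hodge operator. The Lee form is $\vartheta=-\frac17\star(\star d\Phi\wedge\Phi)$. $\Phi$ is balanced if $\star d\Phi\wedge\Phi=0$, locally conformal parallel if $d\Phi=\vartheta\wedge\Phi$, and of mixed type if it is neither balanced nor locally conformal parallel. $G=\mathrm{SU}(3)\times\mathrm{SU}(2)$ and $H=\mathrm{SU}(2)\times\{e\}$, where $\mathrm{SU}(2)\subset\mathrm{SU}(3)$ is the stabilizer of $(1,0,0)\in\mathbb C^3$ (lower right $2\times2$ block). In $\mathfrak{su}(3)$ put, with $\mathcal{E}_{ab}$ the elementary $3\times3$ matrices, $e_1=-\mathcal{E}_{12}+\mathcal{E}_{21}$, $e_2=i(\mathcal{E}_{12}+\mathcal{E}_{21})$, $e_3=\mathcal{E}_{13}-\mathcal{E}_{31}$, $e_4=i(\mathcal{E}_{13}+\mathcal{E}_{31})$, $e_5=\frac1{\sqrt3}\mathrm{diag}(2i,-i,-i)$; in $\mathfrak{su}(2)$ put $e_6=-\frac12\begin{pmatrix}0&i\\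 i&0\end{pmatrix}$, $e_7=\frac12\begin{pmatrix}0&-1\\1&0\end{pmatrix}$, $e_8=\frac12\begin{pmatrix}-i&0\\0&i\end{pmatrix}$, so that $[e_6,e_7]=e_8$, $[e_6,e_8]=-e_7$, $[e_7,e_8]=e_6$. Then $\mathfrak g=\mathfrak h\oplus\mathfrak m$ with $\mathfrak m=\mathrm{span}\{e_1,\dots,e_8\}$ is a reductive decomposition, $\mathfrak m$ is identified with the tangent space at $eH$, and $e^1,\dots,e^8$ is the dual basis. $G$-invariant forms and metrics on $M$ are identified with $\mathrm{Ad}(H)$-invariant forms and inner products on $\mathfrak m$. The metric $g_{t_1,\dots,t_5}$ is what the paper calls the general invariant metric: the left-invariant metric on the $\mathrm{SU}(2)$ factor is put in diagonal form with $0<t_3\le t_4\le t_5$ by an isometric isomorphism of $\mathrm{SU}(2)$. *)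

theory Defs
  imports "HOL-Analysis.Analysis" "HOL-Combinatorics.Permutations"
begin

section \<open>Forms on a real vector space\<close>

text \<open>A \<open>k\<close>-form takes its arguments as a sequence of which only the entries \<open>0, \<dots>, k - 1\<close>
  matter; with this convention equality of \<open>k\<close>-forms is equality of functions.\<close>

type_synonym 'v form = "(nat \<Rightarrow> 'v) \<Rightarrow> real"

definition is_form :: "nat \<Rightarrow> 'v::real_vector form \<Rightarrow> bool" where
  "is_form k \<alpha> \<longleftrightarrow>
     (\<forall>v w. (\<forall>i<k. v i = w i) \<longrightarrow> \<alpha> v = \<alpha> w) \<and>
     (\<forall>v. \<forall>i<k. linear (\<lambda>x. \<alpha> (v(i := x)))) \<and>
     (\<forall>v. \<forall>i<k. \<forall>j<k. i \<noteq> j \<and> v i = v j \<longrightarrow> \<alpha> v = 0)"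

text \<open>The wedge product is normalised by \<open>1 / (p! q!)\<close>, so that
  \<open>f\<^sup>1 \<and> \<dots> \<and> f\<^sup>r\<close> is the determinant \<open>det (f\<^sup>i (v\<^sub>j))\<close>.\<close>

definition wedge :: "nat \<Rightarrow> nat \<Rightarrow> 'v form \<Rightarrow> 'v form \<Rightarrow> 'v form" where
  "wedge p q \<alpha> \<beta> = (\<lambda>v. (\<Sum>\<sigma> | \<sigma> permutes {..<p + q}.
     of_int (sign \<sigma>) * \<alpha> (\<lambda>i. v (\<sigma> i)) * \<beta> (\<lambda>i. v (\<sigma> (p + i)))) / (fact p * fact q))"

fun monomial :: "(nat \<Rightarrow> 'v \<Rightarrow> real) \<Rightarrow> nat list \<Rightarrow> 'v form" where
  "monomial f [] = (\<lambda>v. 1)"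
| "monomial f (i # is) = wedge 1 (length is) (\<lambda>v. f i (v 0)) (monomial f is)"

definition is_coframe :: "(nat \<Rightarrow> 'v::real_vector \<Rightarrow> real) \<Rightarrow> bool" where
  "is_coframe f \<longleftrightarrow>
     (\<forall>i\<in>{1..8}. linear (f i)) \<and>
     (\<forall>c. (\<forall>x. (\<Sum>i=1..8. c i * f i x) = 0) \<longrightarrow> (\<forall>i\<in>{1..8}. c i = 0)) \<and>
     (\<forall>\<alpha>. linear \<alpha> \<longrightarrow> (\<exists>c. \<forall>x. \<alpha> x = (\<Sum>i=1..8. c i * f i x)))"

definition inner_product :: "('v::real_vector \<Rightarrow> 'v \<Rightarrow> real) \<Rightarrow> bool" where
  "inner_product g \<longleftrightarrow>
     (\<forall>x. linear (g x)) \<and> (\<forall>x y. g x y = g y x) \<and> (\<forall>x. x \<noteq> 0 \<longrightarrow> g x x > 0)"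

text \<open>The Hodge operator on \<open>k\<close>-forms of an oriented Euclidean space of dimension 8, with metric
  \<open>g\<close> and orientation given by the 8-form \<open>\<nu>\<close>: the linear operator with
  \<open>\<star>(b\<^sup>1 \<and> \<dots> \<and> b\<^sup>k) = b\<^sup>k\<^sup>+\<^sup>1 \<and> \<dots> \<and> b\<^sup>8\<close> for every positively oriented orthonormal
  basis, which says \<open>(\<star>\<beta>)(b\<^sub>k\<^sub>+\<^sub>1, \<dots>, b\<^sub>8) = \<beta>(b\<^sub>1, \<dots>, b\<^sub>k)\<close>. Bases are indexed from 0 here.\<close>

definition oriented_onb :: "('v \<Rightarrow> 'v \<Rightarrow> real) \<Rightarrow> 'v form \<Rightarrow> (nat \<Rightarrow> 'v) \<Rightarrow> bool" where
  "oriented_onb g \<nu> b \<longleftrightarrow>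
     (\<forall>i<8. \<forall>j<8. g (b i) (b j) = (if i = j then 1 else 0)) \<and> \<nu> b > 0"

definition hodge ::
  "('v::real_vector \<Rightarrow> 'v \<Rightarrow> real) \<Rightarrow> 'v form \<Rightarrow> nat \<Rightarrow> 'v form \<Rightarrow> 'v form" where
  "hodge g \<nu> k \<beta> = (THE \<gamma>. is_form (8 - k) \<gamma> \<and>
     (\<forall>b. oriented_onb g \<nu> b \<longrightarrow> \<gamma> (\<lambda>i. b (k + i)) = \<beta> b))"


section \<open>Admissible 4-forms\<close>

definition model_form :: "(nat \<Rightarrow> 'v \<Rightarrow> real) \<Rightarrow> 'v form" where
  "model_form f = (\<lambda>v.
     monomial f [1,2,3,4] v + monomial f [1,2,5,6] v - monomial f [1,2,7,8] v
   + monomial f [1,3,5,7] v + monomial f [1,3,6,8] v + monomial f [1,4,5,8] v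
   - monomial f [1,4,6,7] v + monomial f [5,6,7,8] v + monomial f [3,4,7,8] v
   - monomial f [3,4,5,6] v + monomial f [2,4,6,8] v + monomial f [2,4,5,7] v
   - monomial f [2,3,5,8] v + monomial f [2,3,6,7] v)"

definition adapted_coframe :: "'v::real_vector form \<Rightarrow> (nat \<Rightarrow> 'v \<Rightarrow> real) \<Rightarrow> bool" where
  "adapted_coframe \<Phi> f \<longleftrightarrow> is_coframe f \<and> \<Phi> = model_form f"

definition admissible :: "'v::real_vector form \<Rightarrow> bool" where
  "admissible \<Phi> \<longleftrightarrow> (\<exists>f. adapted_coframe \<Phi> f)"

text \<open>For admissible \<open>\<Phi>\<close>, neither the metric nor the volume form depends on the adapted
  coframe, because the stabiliser \<open>Spin(7)\<close> of the model form lies in \<open>SO(8)\<close>.\<close>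

definition induced_metric :: "'v::real_vector form \<Rightarrow> 'v \<Rightarrow> 'v \<Rightarrow> real" where
  "induced_metric \<Phi> = (THE g. \<forall>f. adapted_coframe \<Phi> f \<longrightarrow>
     g = (\<lambda>x y. \<Sum>i=1..8. f i x * f i y))"

definition induced_volume :: "'v::real_vector form \<Rightarrow> 'v form" where
  "induced_volume \<Phi> = (THE \<nu>. \<forall>f. adapted_coframe \<Phi> f \<longrightarrow> \<nu> = monomial f [1,2,3,4,5,6,7,8])"

definition star :: "'v::real_vector form \<Rightarrow> nat \<Rightarrow> 'v form \<Rightarrow> 'v form" where
  "star \<Phi> k \<beta> = hodge (induced_metric \<Phi>) (induced_volume \<Phi>) k \<beta>"


section \<open>The homogeneous space\<close>

definition adj :: "complex^'n^'m \<Rightarrow> complex^'m^'n" where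
  "adj A = (\<chi> i j. cnj (A $ j $ i))"

definition SU :: "(complex^'n^'n) set" where
  "SU = {A. adj A ** A = mat 1 \<and> det A = 1}"

definition su :: "(complex^'n^'n) set" where
  "su = {A. adj A = - A \<and> trace A = 0}"

type_synonym matrix_pair = "(complex^3^3) \<times> (complex^2^2)"

definition group_G :: "matrix_pair set" where
  "group_G = SU \<times> SU"

definition group_H :: "matrix_pair set" where
  "group_H = {(A, B). (A, B) \<in> group_G \<and> A *v vector [1, 0, 0] = vector [1, 0, 0] \<and> B = mat 1}"

definition lie_h :: "matrix_pair set" where
  "lie_h = {(X, Y). X \<in> su \<and> X *v vector [1, 0, 0] = 0 \<and> Y = 0}"

definition bracket :: "matrix_pair \<Rightarrow> matrix_pair \<Rightarrow> matrix_pair" where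
  "bracket X Y = (fst X ** fst Y - fst Y ** fst X, snd X ** snd Y - snd Y ** snd X)"

definition Ad :: "matrix_pair \<Rightarrow> matrix_pair \<Rightarrow> matrix_pair" where
  "Ad a X = (fst a ** fst X ** matrix_inv (fst a), snd a ** snd X ** matrix_inv (snd a))"

definition entry :: "'n \<Rightarrow> 'n \<Rightarrow> complex \<Rightarrow> complex^'n^'n" where
  "entry a b z = (\<chi> i j. if i = a \<and> j = b then z else 0)"

definition basis_vec :: "nat \<Rightarrow> matrix_pair" where
  "basis_vec i =
    [(entry 1 2 (-1) + entry 2 1 1, 0),
     (entry 1 2 \<i> + entry 2 1 \<i>, 0),
     (entry 1 3 1 + entry 3 1 (-1), 0),
     (entry 1 3 \<i> + entry 3 1 \<i>, 0),
     ((1 / sqrt 3) *\<^sub>R (entry 1 1 (2 * \<i>) + entry 2 2 (- \<i>) + entry 3 3 (- \<i>)), 0),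
     (0, (- 1 / 2) *\<^sub>R (entry 1 2 \<i> + entry 2 1 \<i>)),
     (0, (1 / 2) *\<^sub>R (entry 1 2 (-1) + entry 2 1 1)),
     (0, (1 / 2) *\<^sub>R (entry 1 1 (- \<i>) + entry 2 2 \<i>))] ! (i - 1)"

text \<open>The complement \<open>\<mm>\<close> of \<open>\<hh>\<close> in \<open>\<gg>\<close>, which is the tangent space of \<open>G/H\<close> at \<open>eH\<close>.\<close>

typedef tangent = "span (basis_vec ` {1..8})"
  morphisms to_lie of_lie
  by (rule exI[of _ 0]) (rule span_zero)

instantiation tangent :: real_vector
begin

definition "0 = of_lie 0"
definition "x + y = of_lie (to_lie x + to_lie y)"
definition "- x = of_lie (- to_lie x)"
definition "x - y = of_lie (to_lie x - to_lie y)"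
definition "c *\<^sub>R x = of_lie (c *\<^sub>R to_lie x)"

instance
proof
  have mem: "to_lie x \<in> span (basis_vec ` {1..8})" for x
    by (rule to_lie)
  have [simp]: "to_lie 0 = 0"
    unfolding zero_tangent_def by (rule of_lie_inverse) (rule span_zero)
  have [simp]: "to_lie (x + y) = to_lie x + to_lie y" for x y
    unfolding plus_tangent_def by (rule of_lie_inverse) (intro span_add mem)
  have [simp]: "to_lie (- x) = - to_lie x" for x
    unfolding uminus_tangent_def by (rule of_lie_inverse) (intro span_neg mem)
  have [simp]: "to_lie (x - y) = to_lie x - to_lie y" for x y
    unfolding minus_tangent_def by (rule of_lie_inverse) (intro span_diff mem)
  have [simp]: "to_lie (c *\<^sub>R x) = c *\<^sub>R to_lie x" for c x
    unfolding scaleR_tangent_def by (rule of_lie_inverse) (intro span_scale mem)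
  note simps = to_lie_inject[symmetric]
  fix x y z :: tangent and a b :: real
  show "x + y + z = x + (y + z)" by (simp add: simps add.assoc)
  show "x + y = y + x" by (simp add: simps add.commute)
  show "0 + x = x" by (simp add: simps)
  show "- x + x = 0" by (simp add: simps)
  show "x - y = x + - y" by (simp add: simps)
  show "a *\<^sub>R (x + y) = a *\<^sub>R x + a *\<^sub>R y" by (simp add: simps scaleR_add_right)
  show "(a + b) *\<^sub>R x = a *\<^sub>R x + b *\<^sub>R x" by (simp add: simps scaleR_add_left)
  show "a *\<^sub>R b *\<^sub>R x = (a * b) *\<^sub>R x" by (simp add: simps)
  show "1 *\<^sub>R x = x" by (simp add: simps)
qed

end

definition frame :: "nat \<Rightarrow> tangent" where
  "frame i = of_lie (basis_vec i)"

definition coframe :: "nat \<Rightarrow> tangent \<Rightarrow> real" where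
  "coframe i x = representation (frame ` {1..8}) x (frame i)"

text \<open>Projection of \<open>\<gg> = \<hh> \<oplus> \<mm>\<close> onto \<open>\<mm>\<close>.\<close>

definition proj_m :: "matrix_pair \<Rightarrow> tangent" where
  "proj_m X = (THE y. X - to_lie y \<in> lie_h)"

definition bracket_m :: "tangent \<Rightarrow> tangent \<Rightarrow> tangent" where
  "bracket_m x y = proj_m (bracket (to_lie x) (to_lie y))"

definition isotropy :: "matrix_pair \<Rightarrow> tangent \<Rightarrow> tangent" where
  "isotropy a x = proj_m (Ad a (to_lie x))"

definition invariant_form :: "tangent form \<Rightarrow> bool" where
  "invariant_form \<alpha> \<longleftrightarrow> (\<forall>a\<in>group_H. \<forall>v. \<alpha> (\<lambda>i. isotropy a (v i)) = \<alpha> v)"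

definition invariant_metric :: "(tangent \<Rightarrow> tangent \<Rightarrow> real) \<Rightarrow> bool" where
  "invariant_metric g \<longleftrightarrow> inner_product g \<and>
     (\<forall>a\<in>group_H. \<forall>x y. g (isotropy a x) (isotropy a y) = g x y)"

text \<open>Exterior derivative of an invariant form on \<open>G/H\<close>, evaluated on \<open>\<mm>\<close>. Pulled back to \<open>G\<close>,
  an invariant form is left-invariant, so that
  \<open>d\<alpha>(X\<^sub>0, \<dots>, X\<^sub>k) = (\<Sum>i<j. (-1)\<^sup>i\<^sup>+\<^sup>j \<alpha>([X\<^sub>i, X\<^sub>j], X\<^sub>0, \<dots>, X\<^sub>k))\<close> with \<open>X\<^sub>i\<close> and \<open>X\<^sub>j\<close>
  omitted from the trailing arguments; since the pull-back is annihilated by \<open>\<hh>\<close>, only the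
  \<open>\<mm>\<close>-component of the bracket contributes.\<close>

definition omit :: "nat \<Rightarrow> (nat \<Rightarrow> 'v) \<Rightarrow> nat \<Rightarrow> 'v" where
  "omit i v = (\<lambda>n. if n < i then v n else v (Suc n))"

definition ext_deriv :: "nat \<Rightarrow> tangent form \<Rightarrow> tangent form" where
  "ext_deriv k \<alpha> = (\<lambda>v. \<Sum>j\<le>k. \<Sum>i<j.
     (-1) ^ (i + j) * \<alpha> (case_nat (bracket_m (v i) (v j)) (omit i (omit j v))))"


section \<open>Invariant Spin(7)-structures and their types\<close>

text \<open>\<open>G\<close>-invariant tensors on \<open>G/H\<close> are identified with \<open>Ad(H)\<close>-invariant tensors on \<open>\<mm>\<close>.
  By invariance, admissibility at \<open>eH\<close> is admissibility at every point.\<close>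

definition invariant_Spin7_structure :: "tangent form \<Rightarrow> bool" where
  "invariant_Spin7_structure \<Phi> \<longleftrightarrow> is_form 4 \<Phi> \<and> invariant_form \<Phi> \<and> admissible \<Phi>"

definition lee_form :: "tangent form \<Rightarrow> tangent form" where
  "lee_form \<Phi> = (\<lambda>v. - (1 / 7) * star \<Phi> 7 (wedge 3 4 (star \<Phi> 5 (ext_deriv 4 \<Phi>)) \<Phi>) v)"

definition balanced :: "tangent form \<Rightarrow> bool" where
  "balanced \<Phi> \<longleftrightarrow> wedge 3 4 (star \<Phi> 5 (ext_deriv 4 \<Phi>)) \<Phi> = (\<lambda>v. 0)"

definition locally_conformal_parallel :: "tangent form \<Rightarrow> bool" where
  "locally_conformal_parallel \<Phi> \<longleftrightarrow> ext_deriv 4 \<Phi> = wedge 1 4 (lee_form \<Phi>) \<Phi>"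

definition mixed_type :: "tangent form \<Rightarrow> bool" where
  "mixed_type \<Phi> \<longleftrightarrow> \<not> balanced \<Phi> \<and> \<not> locally_conformal_parallel \<Phi>"


section \<open>The family of 4-forms and metrics\<close>

abbreviation e_form :: "nat list \<Rightarrow> tangent form" where
  "e_form \<equiv> monomial coframe"

definition Phi :: "real \<Rightarrow> real \<Rightarrow> real \<Rightarrow> real \<Rightarrow> real \<Rightarrow> tangent form" where
  "Phi t1 t2 t3 t4 t5 = (\<lambda>v.
     t1^4 * e_form [1,2,3,4] v
   + t1^2 * t2 * t3 * (e_form [1,2,5,6] v - e_form [3,4,5,6] v)
   + t1^2 * t4 * t5 * (e_form [3,4,7,8] v - e_form [1,2,7,8] v)
   + t1^2 * t2 * t4 * (e_form [1,3,5,7] v + e_form [2,4,5,7] v)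
   + t1^2 * t3 * t5 * (e_form [1,3,6,8] v + e_form [2,4,6,8] v)
   + t1^2 * t2 * t5 * (e_form [1,4,5,8] v - e_form [2,3,5,8] v)
   + t1^2 * t3 * t4 * (e_form [2,3,6,7] v - e_form [1,4,6,7] v)
   + t2 * t3 * t4 * t5 * e_form [5,6,7,8] v)"

definition diag_metric :: "real \<Rightarrow> real \<Rightarrow> real \<Rightarrow> real \<Rightarrow> real \<Rightarrow> tangent \<Rightarrow> tangent \<Rightarrow> real" where
  "diag_metric t1 t2 t3 t4 t5 = (\<lambda>x y.
     t1^2 * (\<Sum>i=1..4. coframe i x * coframe i y)
   + t2^2 * (coframe 5 x * coframe 5 y)
   + t3^2 * (coframe 6 x * coframe 6 y)
   + t4^2 * (coframe 7 x * coframe 7 y)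
   + t5^2 * (coframe 8 x * coframe 8 y))"

end

theory Submission
  imports Defs
begin

text \<open>Everything is computed in the coframe \<open>F\<close> obtained from \<open>e\<^sup>1, \<dots>, e\<^sup>8\<close> by rescaling with the
  \<open>t\<^sub>i\<close>: it is adapted to the 4-form, and each \<open>dF\<^sup>i\<close> is a combination of at most two monomials
  \<open>F\<^sup>a\<^sup>b\<close>. A linear combination of monomials is represented by a list of coefficients and index lists,
  on which wedge product, Hodge operator and exterior derivative act by concatenation and sorting.

  That metric and volume form depend only on the 4-form \<open>\<Phi>\<close> is seen as follows. The volume form is
  \<open>\<Phi> \<and> \<Phi> / 14\<close>. With \<open>\<omega> = \<Phi>(u, w, \<cdot>, \<cdot>)\<close>, the 8-form \<open>\<omega> \<and> \<omega> \<and> \<Phi>\<close> is \<open>-6\<close> times the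
  squared area of the parallelogram spanned by \<open>u\<close> and \<open>w\<close>, because \<open>T = \<star>(\<cdot> \<and> \<Phi>)\<close> satisfies
  \<open>T\<^sup>2 = 3 - 2 T\<close> on 2-forms and \<open>\<omega> = T(u\<^sup>\<flat> \<and> w\<^sup>\<flat>)\<close>. An inner product on a space of dimension
  at least 3 is determined by these areas.\<close>

section \<open>Alternation and monomials\<close>

text \<open>The induced metric, the induced volume form and the Hodge operator are definite
  descriptions that range over all adapted coframes or over all oriented orthonormal bases. A
  computation in \<open>F\<close> says nothing about them until every competitor is controlled:
  hence the uniqueness argument for arbitrary adapted coframes and, for the Hodge operator, an
  identity between complementary minors of an arbitrary orthonormal basis. Areas serve to recover
  the metric because they come out of \<Phi> by contraction and wedge products alone, which involve
  no coframe. The relation for T is (T + 3)(T - 1) = 0. No monomial occurs in its own image under T,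
  so T is traceless, and on the 28-dimensional space of 2-forms its eigenvalues -3 and 1 have
  multiplicities 7 and 21.\<close>

definition alternate :: "nat \<Rightarrow> 'v form \<Rightarrow> 'v form" where
  "alternate n F = (\<lambda>v. \<Sum>\<sigma> | \<sigma> permutes {..<n}. of_int (sign \<sigma>) * F (\<lambda>i. v (\<sigma> i)))"

lemma sign_compose_permutes:
  assumes "finite S" "p permutes S" "q permutes S"
  shows "sign (p \<circ> q) = sign p * sign q"
  using assms by (intro sign_compose permutes_imp_permutation)

lemma alternate_permute:
  assumes "\<tau> permutes {..<n}"
  shows "alternate n F (\<lambda>i. v (\<tau> i)) = of_int (sign \<tau>) * alternate n F v"
proof -
  have "alternate n F v = (\<Sum>\<sigma> | \<sigma> permutes {..<n}. of_int (sign (\<tau> \<circ> \<sigma>)) * F (\<lambda>i. v ((\<tau> \<circ> \<sigma>) i)))"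
    unfolding alternate_def by (rule setum_permutations_compose_left[OF assms])
  also have "\<dots> = (\<Sum>\<sigma> | \<sigma> permutes {..<n}. of_int (sign \<tau>) * (of_int (sign \<sigma>) * F (\<lambda>i. v (\<tau> (\<sigma> i)))))"
    by (rule sum.cong) (auto simp: sign_compose_permutes[OF finite_lessThan assms])
  also have "\<dots> = of_int (sign \<tau>) * alternate n F (\<lambda>i. v (\<tau> i))"
    by (simp add: alternate_def sum_distrib_left)
  finally have "of_int (sign \<tau>) * alternate n F v = of_int (sign \<tau> * sign \<tau>) * alternate n F (\<lambda>i. v (\<tau> i))"
    by (simp only: of_int_mult mult.assoc)
  then show ?thesis by simp
qed

text \<open>The transposition of i and j leaves v unchanged but reverses the sign of the
  value.\<close>

lemma alternate_eq_0:
  assumes "i < n" "j < n" "i \<noteq> j" "v i = v j"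
  shows "alternate n F v = 0"
proof -
  have "(\<lambda>k. v (Transposition.transpose i j k)) = v"
    using assms(4) by (auto simp: Transposition.transpose_def fun_eq_iff)
  then have "alternate n F v = of_int (sign (Transposition.transpose i j)) * alternate n F v"
    using alternate_permute[of "Transposition.transpose i j" n F v] assms by (simp add: permutes_swap_id)
  then show ?thesis using assms by (simp add: sign_swap_id)
qed

text \<open>Every pair \<open>(\<tau>, \<rho>)\<close> of permutations of the two blocks of slots contributes the same sum
  over \<open>\<sigma>\<close>, which accounts for the factor \<open>p! q!\<close>.\<close>

lemma wedge_alternate:
  assumes F: "\<And>v w. (\<forall>i<p. v i = w i) \<Longrightarrow> F v = F w"
    and G: "\<And>v w. (\<forall>i<q. v i = w i) \<Longrightarrow> G v = G w"
  shows "wedge p q (alternate p F) (alternate q G) = alternate (p + q) (\<lambda>v. F v * G (\<lambda>i. v (p + i)))"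
proof
  fix v
  let ?S = "{\<sigma>. \<sigma> permutes {..<p + q}}" and ?P = "{\<tau>. \<tau> permutes {..<p}}" and ?Q = "{\<rho>. \<rho> permutes {..<q}}"
  let ?H = "\<lambda>v. F v * G (\<lambda>i. v (p + i))"
  let ?A = "alternate (p + q) ?H v"
  have block: "(\<Sum>\<sigma>\<in>?S. of_int (sign \<sigma>) * (of_int (sign \<tau>) * F (\<lambda>i. v (\<sigma> (\<tau> i)))) *
      (of_int (sign \<rho>) * G (\<lambda>i. v (\<sigma> (p + \<rho> i))))) = ?A" if "\<tau> \<in> ?P" "\<rho> \<in> ?Q" for \<tau> \<rho>
  proof -
    have t: "\<tau> permutes {..<p}" and r: "\<rho> permutes {..<q}" using that by auto
    define \<rho>' where "\<rho>' = map_permutation {..<q} ((+) p) \<rho>"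
    have r1: "\<rho>' permutes {p..<p + q}"
      unfolding \<rho>'_def by (rule map_permutation_permutes[OF _ r])
        (auto simp: bij_betw_def image_add_atLeastLessThan lessThan_atLeast0)
    have r2: "sign \<rho>' = sign \<rho>"
      unfolding \<rho>'_def by (rule sign_map_permutation[OF _ r]) auto
    have r3: "\<rho>' (p + i) = p + \<rho> i" if "i < q" for i
      unfolding \<rho>'_def using that by (intro map_permutation_apply) auto
    have r4: "\<rho>' i = i" if "i < p" for i
      using r1 that by (auto simp: permutes_def)
    have t1: "\<tau> i < p" if "i < p" for i
      using permutes_in_image[OF t, of i] that by simp
    have t2: "\<tau> i = i" if "p \<le> i" for i
      using t that by (auto simp: permutes_def)
    have "\<tau> permutes {..<p + q}" "\<rho>' permutes {..<p + q}"
      by (rule permutes_subset[OF t]; auto) (rule permutes_subset[OF r1]; auto)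
    then have perm: "\<tau> \<circ> \<rho>' permutes {..<p + q}" and
      sg: "sign (\<tau> \<circ> \<rho>') = sign \<tau> * sign \<rho>"
      by (auto simp: permutes_compose r2 sign_compose_permutes[of "{..<p + q}"])
    have "?A = (\<Sum>\<sigma>\<in>?S. of_int (sign (\<sigma> \<circ> (\<tau> \<circ> \<rho>'))) * ?H (\<lambda>i. v ((\<sigma> \<circ> (\<tau> \<circ> \<rho>')) i)))"
      unfolding alternate_def by (rule sum_permutations_compose_right[OF perm])
    also have "\<dots> = (\<Sum>\<sigma>\<in>?S. of_int (sign \<sigma>) * (of_int (sign \<tau>) * F (\<lambda>i. v (\<sigma> (\<tau> i)))) *
      (of_int (sign \<rho>) * G (\<lambda>i. v (\<sigma> (p + \<rho> i)))))"
    proof (rule sum.cong[OF refl])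
      fix \<sigma> assume "\<sigma> \<in> ?S"
      then have "sign (\<sigma> \<circ> (\<tau> \<circ> \<rho>')) = sign \<sigma> * (sign \<tau> * sign \<rho>)"
        using perm by (subst sign_compose_permutes[of "{..<p + q}"]) (auto simp: sg)
      moreover have "F (\<lambda>i. v ((\<sigma> \<circ> (\<tau> \<circ> \<rho>')) i)) = F (\<lambda>i. v (\<sigma> (\<tau> i)))"
        by (rule F) (simp add: r4)
      moreover have "G (\<lambda>i. v ((\<sigma> \<circ> (\<tau> \<circ> \<rho>')) (p + i))) = G (\<lambda>i. v (\<sigma> (p + \<rho> i)))"
        by (rule G) (simp add: r3 t2)
      ultimately show "of_int (sign (\<sigma> \<circ> (\<tau> \<circ> \<rho>'))) * ?H (\<lambda>i. v ((\<sigma> \<circ> (\<tau> \<circ> \<rho>')) i)) =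
        of_int (sign \<sigma>) * (of_int (sign \<tau>) * F (\<lambda>i. v (\<sigma> (\<tau> i)))) *
        (of_int (sign \<rho>) * G (\<lambda>i. v (\<sigma> (p + \<rho> i))))"
        by simp
    qed
    finally show ?thesis by simp
  qed
  have "(\<Sum>\<sigma>\<in>?S. of_int (sign \<sigma>) * alternate p F (\<lambda>i. v (\<sigma> i)) * alternate q G (\<lambda>i. v (\<sigma> (p + i))))
    = (\<Sum>\<sigma>\<in>?S. \<Sum>\<tau>\<in>?P. \<Sum>\<rho>\<in>?Q. of_int (sign \<sigma>) * (of_int (sign \<tau>) * F (\<lambda>i. v (\<sigma> (\<tau> i)))) *
      (of_int (sign \<rho>) * G (\<lambda>i. v (\<sigma> (p + \<rho> i)))))"
    unfolding alternate_def by (intro sum.cong refl) (simp only: sum_product[symmetric] sum_distrib_left[symmetric] sum_distrib_right[symmetric])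
  also have "\<dots> = (\<Sum>\<tau>\<in>?P. \<Sum>\<rho>\<in>?Q. \<Sum>\<sigma>\<in>?S. of_int (sign \<sigma>) * (of_int (sign \<tau>) * F (\<lambda>i. v (\<sigma> (\<tau> i)))) *
      (of_int (sign \<rho>) * G (\<lambda>i. v (\<sigma> (p + \<rho> i)))))"
    by (subst sum.swap, rule sum.cong[OF refl], subst sum.swap, rule refl)
  also have "\<dots> = (\<Sum>\<tau>\<in>?P. \<Sum>\<rho>\<in>?Q. ?A)"
    by (intro sum.cong refl block)
  also have "\<dots> = fact p * fact q * ?A"
    by (simp add: card_permutations)
  finally show "wedge p q (alternate p F) (alternate q G) v = ?A"
    by (simp add: wedge_def)
qed

text \<open>The unnormalised \<open>alternate\<close> of a product of 1-forms is the Leibniz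
  expansion of a determinant. Written this way, rules for monomials become rules for determinants,
  and associativity of the wedge product on monomials comes out of
  \<open>wedge_alternate\<close>.\<close>

lemma monomial_alternate:
  "monomial f I = alternate (length I) (\<lambda>v. \<Prod>i<length I. f (I ! i) (v i))"
proof (induction I)
  case Nil
  have "{\<sigma>. \<sigma> permutes {..<0 :: nat}} = {id}" by auto
  then show ?case unfolding alternate_def by (simp add: fun_eq_iff)
next
  case (Cons a I)
  have "{\<sigma>. \<sigma> permutes {..<1 :: nat}} = {id}"
    by (auto simp: lessThan_Suc)
  then have "(\<lambda>v. f a (v 0)) = alternate 1 (\<lambda>v. f a (v 0))"
    unfolding alternate_def by (simp add: fun_eq_iff)
  then have "monomial f (a # I) = wedge 1 (length I) (alternate 1 (\<lambda>v. f a (v 0)))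
      (alternate (length I) (\<lambda>v. \<Prod>i<length I. f (I ! i) (v i)))"
    using Cons by simp
  also have "\<dots> = alternate (1 + length I) (\<lambda>v. f a (v 0) * (\<Prod>i<length I. f (I ! i) (v (1 + i))))"
    by (rule wedge_alternate) (auto intro!: prod.cong)
  also have "\<dots> = alternate (length (a # I)) (\<lambda>v. \<Prod>i<length (a # I). f ((a # I) ! i) (v i))"
    by (simp add: prod.lessThan_Suc_shift del: prod.lessThan_Suc)
  finally show ?case .
qed

declare monomial.simps(2) [simp del]

lemma wedge_monomial:
  "wedge (length I) (length J) (monomial f I) (monomial f J) = monomial f (I @ J)"
proof -
  have "wedge (length I) (length J) (monomial f I) (monomial f J) = alternate (length I + length J)
    (\<lambda>v. (\<Prod>i<length I. f (I ! i) (v i)) * (\<Prod>i<length J. f (J ! i) (v (length I + i))))"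
    unfolding monomial_alternate by (rule wedge_alternate) (auto intro!: prod.cong)
  also have "\<dots> = monomial f (I @ J)"
    unfolding monomial_alternate
  proof (simp, intro arg_cong[where f = "alternate _"] ext)
    fix v
    have "(\<Prod>i<length I + length J. f ((I @ J) ! i) (v i)) =
      (\<Prod>i<length I. f ((I @ J) ! i) (v i)) * (\<Prod>i\<in>{length I..<length I + length J}. f ((I @ J) ! i) (v i))"
      by (subst prod.union_disjoint[symmetric]) (auto intro: prod.cong)
    also have "(\<Prod>i\<in>{length I..<length I + length J}. f ((I @ J) ! i) (v i)) =
      (\<Prod>i<length J. f (J ! i) (v (length I + i)))"
      by (rule prod.reindex_bij_witness[of _ "\<lambda>i. length I + i" "\<lambda>i. i - length I"])
         (auto simp: nth_append)
    also have "(\<Prod>i<length I. f ((I @ J) ! i) (v i)) = (\<Prod>i<length I. f (I ! i) (v i))"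
      by (simp add: nth_append)
    finally show "(\<Prod>i<length I. f (I ! i) (v i)) * (\<Prod>i<length J. f (J ! i) (v (length I + i))) =
      (\<Prod>i<length I + length J. f ((I @ J) ! i) (v i))" by simp
  qed
  finally show ?thesis .
qed

lemma linear_mult_const_left:
  fixes g :: "'v::real_vector \<Rightarrow> real"
  shows "linear g \<Longrightarrow> linear (\<lambda>x. c * g x)"
  by (auto simp: linear_iff algebra_simps)

lemma is_form_monomial:
  assumes "\<And>i. i \<in> set I \<Longrightarrow> linear (f i)"
  shows "is_form (length I) (monomial f I)"
  unfolding is_form_def
proof (intro conjI allI impI)
  fix v w :: "nat \<Rightarrow> 'a" assume "\<forall>i<length I. v i = w i"
  then show "monomial f I v = monomial f I w"
    unfolding monomial_alternate alternate_def
  proof (intro sum.cong arg_cong2[where f = "(*)"] prod.cong refl)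
    fix \<sigma> i assume "\<sigma> \<in> {\<sigma>. \<sigma> permutes {..<length I}}" "i \<in> {..<length I}"
    then have "\<sigma> i < length I" using permutes_in_image[of \<sigma> "{..<length I}" i] by simp
    then show "f (I ! i) (v (\<sigma> i)) = f (I ! i) (w (\<sigma> i))"
      using \<open>\<forall>i<length I. v i = w i\<close> by simp
  qed
next
  fix v :: "nat \<Rightarrow> 'a" and k assume k: "k < length I"
  have "linear (\<lambda>x. \<Prod>i<length I. f (I ! i) ((v(k := x)) (\<sigma> i)))"
    if s: "\<sigma> permutes {..<length I}" for \<sigma>
  proof -
    \<comment> \<open>Only the factor with index \<open>inv \<sigma> k\<close> sees the slot k, so
      the product is a constant times one linear function.\<close>
    define j where "j = inv \<sigma> k"
    have j: "j < length I" "\<sigma> j = k"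
      using permutes_in_image[OF permutes_inv[OF s], of k] k permutes_inverses(1)[OF s]
      by (auto simp: j_def)
    have ne: "\<sigma> i \<noteq> k" if "i \<noteq> j" for i
      using that j permutes_inj[OF s] by (auto dest: injD)
    have "(\<Prod>i<length I. f (I ! i) ((v(k := x)) (\<sigma> i))) =
        (\<Prod>i\<in>{..<length I} - {j}. f (I ! i) (v (\<sigma> i))) * f (I ! j) x" for x
    proof -
      have "(\<Prod>i<length I. f (I ! i) ((v(k := x)) (\<sigma> i))) = f (I ! j) ((v(k := x)) (\<sigma> j)) *
        (\<Prod>i\<in>{..<length I} - {j}. f (I ! i) ((v(k := x)) (\<sigma> i)))"
        using j by (intro prod.remove) auto
      also have "(\<Prod>i\<in>{..<length I} - {j}. f (I ! i) ((v(k := x)) (\<sigma> i))) =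
        (\<Prod>i\<in>{..<length I} - {j}. f (I ! i) (v (\<sigma> i)))"
        using ne by (intro prod.cong) auto
      finally show ?thesis using j by simp
    qed
    moreover have "linear (f (I ! j))" using assms j by simp
    ultimately show ?thesis
      by (simp only: linear_mult_const_left)
  qed
  then show "linear (\<lambda>x. monomial f I (v(k := x)))"
    unfolding monomial_alternate alternate_def
    by (intro linear_compose_sum ballI linear_mult_const_left) simp
next
  fix v :: "nat \<Rightarrow> 'a" and i j assume "i < length I" "j < length I" "i \<noteq> j \<and> v i = v j"
  then show "monomial f I v = 0"
    unfolding monomial_alternate by (intro alternate_eq_0[of i _ j]) auto
qed


section \<open>Alternating forms under permutation of their arguments\<close>

lemma is_form_cong: "is_form k \<alpha> \<Longrightarrow> (\<And>i. i < k \<Longrightarrow> v i = w i) \<Longrightarrow> \<alpha> v = \<alpha> w"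
  by (simp add: is_form_def)

lemma is_form_linear: "is_form k \<alpha> \<Longrightarrow> i < k \<Longrightarrow> linear (\<lambda>x. \<alpha> (v(i := x)))"
  by (simp add: is_form_def)

lemma is_form_eq_0: "is_form k \<alpha> \<Longrightarrow> i < k \<Longrightarrow> j < k \<Longrightarrow> i \<noteq> j \<Longrightarrow> v i = v j \<Longrightarrow> \<alpha> v = 0"
  unfolding is_form_def by metis

text \<open>Polarisation: with x + y in both slots the value vanishes, the two diagonal terms vanish
  as well, so the mixed ones cancel.\<close>

lemma is_form_swap:
  assumes \<alpha>: "is_form k \<alpha>" and ij: "i < k" "j < k" "i \<noteq> j"
  shows "\<alpha> (\<lambda>m. v (Transposition.transpose i j m)) = - \<alpha> v"
proof -
  let ?G = "\<lambda>x y. \<alpha> (v(i := x, j := y))"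
  have l1: "linear (?G x)" for x
    using is_form_linear[OF \<alpha> ij(2), of "v(i := x)"] .
  have l2: "linear (\<lambda>x. ?G x y)" for y
    using is_form_linear[OF \<alpha> ij(1), of "v(j := y)"] by (simp add: fun_upd_twist[OF ij(3)])
  have diag: "?G x x = 0" for x
    by (rule is_form_eq_0[OF \<alpha> ij]) (use ij in simp)
  have "?G (x + y) (x + y) = ?G x x + ?G x y + (?G y x + ?G y y)" for x y
    by (simp only: linear_add[OF l1] linear_add[OF l2])
  then have "?G x y = - ?G y x" for x y
    using diag[of x] diag[of y] diag[of "x + y"] by (simp add: algebra_simps)
  then have "?G (v j) (v i) = - ?G (v i) (v j)" .
  moreover have "v(i := v j, j := v i) = (\<lambda>m. v (Transposition.transpose i j m))"
    by (auto simp: fun_eq_iff Transposition.transpose_def)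
  ultimately show ?thesis by (metis fun_upd_triv)
qed

lemma is_form_permute:
  assumes \<alpha>: "is_form k \<alpha>" and p: "p permutes {..<k}"
  shows "\<alpha> (\<lambda>i. v (p i)) = of_int (sign p) * \<alpha> v"
  using p finite_lessThan
proof (induction p arbitrary: v rule: permutes_induct)
  case id
  then show ?case by simp
next
  case (swap a b p)
  have "\<alpha> (\<lambda>i. v ((Transposition.transpose a b \<circ> p) i)) =
      of_int (sign p) * \<alpha> (\<lambda>i. v (Transposition.transpose a b i))"
    using swap.IH[of "\<lambda>i. v (Transposition.transpose a b i)"] by simp
  also have "\<dots> = - (of_int (sign p) * \<alpha> v)"
    using is_form_swap[OF \<alpha>, of a b v] swap by simp
  also have "\<dots> = of_int (sign (Transposition.transpose a b \<circ> p)) * \<alpha> v"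
    using swap by (simp add: sign_compose_permutes[of "{..<k}"] permutes_swap_id sign_swap_id)
  finally show ?case .
qed

text \<open>The antiderivation property of the contraction with \<open>v 0\<close>.\<close>

lemma wedge_contract:
  assumes \<beta>: "is_form n \<beta>"
  shows "wedge 1 n (\<lambda>v. f (v 0)) \<beta> v = f (v 0) * \<beta> (\<lambda>i. v (Suc i))
    - (\<Sum>m<n. f (v (Suc m)) * \<beta> ((\<lambda>i. v (Suc i))(m := v 0)))"
proof -
  let ?S = "Suc ` {..<n}"
  let ?T = "\<lambda>b. Transposition.transpose 0 (b :: nat)"
  let ?g = "\<lambda>\<sigma>. of_int (sign \<sigma>) * f (v (\<sigma> 0)) * \<beta> (\<lambda>i. v (\<sigma> (1 + i)))"
  have fin: "finite ?S" and n0: "0 \<notin> ?S" by auto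
  \<comment> \<open>A permutation of the slots 1, ..., n acts on the arguments of \<beta> as its
    conjugate by the predecessor map, which has the same sign.\<close>
  have shift: "\<beta> (\<lambda>i. w (q (Suc i))) = of_int (sign q) * \<beta> (\<lambda>i. w (Suc i))"
    if q: "q permutes ?S" for q and w :: "nat \<Rightarrow> 'a"
  proof -
    define q' where "q' = map_permutation ?S (\<lambda>x. x - 1) q"
    have inj: "inj_on (\<lambda>x. x - 1 :: nat) ?S" by (rule inj_onI) auto
    have q': "q' permutes {..<n}"
      unfolding q'_def
      by (rule map_permutation_permutes[OF bij_betw_imageI[OF inj] q]) (simp add: image_image)
    have sg: "sign q' = sign q"
      unfolding q'_def by (rule sign_map_permutation[OF inj q fin])
    have "q (Suc i) = Suc (q' i)" if "i < n" for i
    proof -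
      have "q' (Suc i - 1) = q (Suc i) - 1"
        unfolding q'_def by (rule map_permutation_apply[OF inj]) (use that in auto)
      moreover have "q (Suc i) \<in> ?S"
        using permutes_in_image[OF q, of "Suc i"] that by simp
      ultimately show ?thesis by auto
    qed
    then have "\<beta> (\<lambda>i. w (q (Suc i))) = \<beta> (\<lambda>i. w (Suc (q' i)))"
      by (intro is_form_cong[OF \<beta>]) simp
    also have "\<dots> = of_int (sign q') * \<beta> (\<lambda>i. w (Suc i))"
      by (rule is_form_permute[OF \<beta> q', of "\<lambda>i. w (Suc i)"])
    finally show ?thesis by (simp add: sg)
  qed
  have contract: "(\<lambda>i. v (?T (Suc m) (Suc i))) = (\<lambda>i. v (Suc i))(m := v 0)" for m
    by (auto simp: Transposition.transpose_def)
  have "(\<Sum>\<sigma> | \<sigma> permutes {..<1 + n}. ?g \<sigma>) = (\<Sum>\<sigma> | \<sigma> permutes insert 0 ?S. ?g \<sigma>)"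
    by (simp add: lessThan_Suc_eq_insert_0)
  \<comment> \<open>Each \<sigma> is a permutation q fixing 0, followed by the transposition of 0
    and b = \<sigma> 0. By \<open>shift\<close> the value does not depend on q, so each b receives
    n! equal terms, which cancel the factor in \<open>wedge\<close>.\<close>
  also have "\<dots> = (\<Sum>b\<in>insert 0 ?S. \<Sum>q | q permutes ?S. ?g (?T b \<circ> q))"
    by (rule sum_over_permutations_insert[OF fin n0])
  also have "\<dots> = (\<Sum>b\<in>insert 0 ?S. \<Sum>q | q permutes ?S.
      of_int (sign (?T b)) * f (v b) * \<beta> (\<lambda>i. v (?T b (Suc i))))"
  proof (intro sum.cong refl)
    fix b q assume b: "b \<in> insert 0 ?S" and "q \<in> {q. q permutes ?S}"
    then have q: "q permutes ?S" by simp
    have q0: "q 0 = 0" using q n0 by (auto simp: permutes_def)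
    have sg: "sign (?T b \<circ> q) = sign (?T b) * sign q"
      using permutes_imp_permutation[OF fin q] by (simp add: sign_compose permutation_swap_id)
    show "?g (?T b \<circ> q) = of_int (sign (?T b)) * f (v b) * \<beta> (\<lambda>i. v (?T b (Suc i)))"
      using shift[OF q, of "\<lambda>i. v (?T b i)"] by (simp add: sg q0) (simp flip: of_int_mult mult.assoc)
  qed
  also have "\<dots> = (\<Sum>b\<in>insert 0 ?S. fact n * (of_int (sign (?T b)) * f (v b) * \<beta> (\<lambda>i. v (?T b (Suc i)))))"
    using card_permutations[of ?S n] by (simp add: card_image)
  also have "\<dots> = fact n * (f (v 0) * \<beta> (\<lambda>i. v (Suc i))
      - (\<Sum>m<n. f (v (Suc m)) * \<beta> (\<lambda>i. v (?T (Suc m) (Suc i)))))"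
    by (simp add: sum.reindex sign_swap_id sum_distrib_left sum_negf algebra_simps)
  finally show ?thesis
    unfolding wedge_def contract by simp
qed

text \<open>Laplace expansion along the first row. The removed argument is replaced by
  \<open>v 0\<close> in its slot instead of shifting the later arguments, so all remaining terms
  carry the same minus sign.\<close>

lemma monomial_Cons_eval:
  assumes "\<And>i. i \<in> set I \<Longrightarrow> linear (f i)"
  shows "monomial f (a # I) v = f a (v 0) * monomial f I (\<lambda>i. v (Suc i))
    - (\<Sum>m<length I. f a (v (Suc m)) * monomial f I ((\<lambda>i. v (Suc i))(m := v 0)))"
  using wedge_contract[OF is_form_monomial[OF assms]] by (simp add: monomial.simps)

text \<open>A determinant with a zero column: every Leibniz product contains an entry of that
  column.\<close>

lemma monomial_eq_0:
  assumes "k < length I" "\<And>i. i \<in> set I \<Longrightarrow> f i (v k) = 0"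
  shows "monomial f I v = 0"
  unfolding monomial_alternate alternate_def
proof (intro sum.neutral ballI)
  fix \<sigma> assume "\<sigma> \<in> {\<sigma>. \<sigma> permutes {..<length I}}"
  then have s: "\<sigma> permutes {..<length I}" by simp
  then have "inv \<sigma> k < length I" "\<sigma> (inv \<sigma> k) = k"
    using permutes_in_image[OF permutes_inv[OF s], of k] assms permutes_inverses(1)[OF s] by auto
  then have "\<exists>i\<in>{..<length I}. f (I ! i) (v (\<sigma> i)) = 0"
    using assms(2) by (intro bexI[of _ "inv \<sigma> k"]) auto
  then show "of_int (sign \<sigma>) * (\<Prod>i<length I. f (I ! i) (v (\<sigma> i))) = 0"
    by (simp add: prod_zero_iff)
qed

lemma monomial_contract:
  assumes "\<And>i. i \<in> set I \<Longrightarrow> linear (f i)" "\<And>i. i \<in> set I \<Longrightarrow> f i (v 0) = 0"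
  shows "monomial f (a # I) v = f a (v 0) * monomial f I (\<lambda>i. v (Suc i))"
proof -
  have "monomial f I ((\<lambda>i. v (Suc i))(m := v 0)) = 0" if "m < length I" for m
    using that assms by (intro monomial_eq_0[of m]) auto
  then show ?thesis by (simp add: monomial_Cons_eval assms)
qed

lemma monomial_args_cong:
  assumes "\<And>i. i < length I \<Longrightarrow> v i = w i" shows "monomial f I v = monomial f I w"
  unfolding monomial_alternate alternate_def
proof (intro sum.cong arg_cong2[where f = "(*)"] prod.cong refl)
  fix \<sigma> i assume "\<sigma> \<in> {\<sigma>. \<sigma> permutes {..<length I}}" "i \<in> {..<length I}"
  then have "\<sigma> i < length I" using permutes_in_image[of \<sigma> "{..<length I}" i] by simp
  then show "f (I ! i) (v (\<sigma> i)) = f (I ! i) (w (\<sigma> i))" using assms by simp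
qed

text \<open>Invariance of the determinant under transposition. Two families of functionals occur
  because the same matrix is read once as components of b in the frame and once as components of the
  frame in b.\<close>

lemma monomial_transpose:
  assumes "\<And>i j. i < length I \<Longrightarrow> j < length J \<Longrightarrow> f (I ! i) (v j) = g (J ! j) (w i)" "length I = length J"
  shows "monomial f I v = monomial g J w"
proof -
  let ?n = "length I"
  have "monomial f I v = (\<Sum>\<sigma> | \<sigma> permutes {..<?n}. of_int (sign (inv \<sigma>)) * (\<Prod>i<?n. f (I ! i) (v (inv \<sigma> i))))"
    unfolding monomial_alternate alternate_def by (subst sum_permutations_inverse) simp
  also have "\<dots> = (\<Sum>\<sigma> | \<sigma> permutes {..<?n}. of_int (sign \<sigma>) * (\<Prod>i<?n. g (J ! i) (w (\<sigma> i))))"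
  proof (intro sum.cong arg_cong2[where f = "(*)"] refl)
    fix \<sigma> assume "\<sigma> \<in> {\<sigma>. \<sigma> permutes {..<?n}}"
    then have s: "\<sigma> permutes {..<?n}" by simp
    show "real_of_int (sign (inv \<sigma>)) = of_int (sign \<sigma>)"
      using permutes_imp_permutation[OF _ s] by (simp add: sign_inverse)
    have "(\<Prod>i<?n. f (I ! i) (v (inv \<sigma> i))) = (\<Prod>i<?n. f (I ! (\<sigma> i)) (v (inv \<sigma> (\<sigma> i))))"
      using prod.permute[OF s] by (simp add: o_def)
    also have "\<dots> = (\<Prod>i<?n. g (J ! i) (w (\<sigma> i)))"
      using assms permutes_in_image[OF s] permutes_inverses(2)[OF s] by (intro prod.cong) auto
    finally show "(\<Prod>i<?n. f (I ! i) (v (inv \<sigma> i))) = (\<Prod>i<?n. g (J ! i) (w (\<sigma> i)))" .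
  qed
  finally show ?thesis
    unfolding monomial_alternate alternate_def by (simp add: assms(2))
qed


section \<open>Linear operations on forms, and forms that vanish on a frame\<close>

lemma is_form_0: "is_form k (\<lambda>v. 0)"
  by (simp add: is_form_def linear_iff)

lemma is_form_add:
  assumes \<alpha>: "is_form k \<alpha>" and \<beta>: "is_form k \<beta>" shows "is_form k (\<lambda>v. \<alpha> v + \<beta> v)"
  unfolding is_form_def
proof (intro conjI allI impI)
  fix v w :: "nat \<Rightarrow> 'a" assume "\<forall>i<k. v i = w i"
  then show "\<alpha> v + \<beta> v = \<alpha> w + \<beta> w"
    using is_form_cong[OF \<alpha>, of v w] is_form_cong[OF \<beta>, of v w] by simp
next
  fix v :: "nat \<Rightarrow> 'a" and i assume "i < k"
  then show "linear (\<lambda>x. \<alpha> (v(i := x)) + \<beta> (v(i := x)))"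
    by (intro linear_compose_add is_form_linear[OF \<alpha>] is_form_linear[OF \<beta>])
next
  fix v :: "nat \<Rightarrow> 'a" and i j assume "i < k" "j < k" "i \<noteq> j \<and> v i = v j"
  then show "\<alpha> v + \<beta> v = 0"
    using is_form_eq_0[OF \<alpha>, of i j v] is_form_eq_0[OF \<beta>, of i j v] by simp
qed

lemma is_form_mult:
  assumes \<alpha>: "is_form k \<alpha>" shows "is_form k (\<lambda>v. c * \<alpha> v)"
  unfolding is_form_def
proof (intro conjI allI impI)
  fix v w :: "nat \<Rightarrow> 'a" assume "\<forall>i<k. v i = w i"
  then show "c * \<alpha> v = c * \<alpha> w"
    using is_form_cong[OF \<alpha>, of v w] by simp
next
  fix v :: "nat \<Rightarrow> 'a" and i assume "i < k"
  then show "linear (\<lambda>x. c * \<alpha> (v(i := x)))"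
    by (intro linear_mult_const_left is_form_linear[OF \<alpha>])
next
  fix v :: "nat \<Rightarrow> 'a" and i j assume "i < k" "j < k" "i \<noteq> j \<and> v i = v j"
  then show "c * \<alpha> v = 0"
    using is_form_eq_0[OF \<alpha>, of i j v] by simp
qed

lemma is_form_diff:
  assumes "is_form k \<alpha>" "is_form k \<beta>" shows "is_form k (\<lambda>v. \<alpha> v - \<beta> v)"
proof -
  have "is_form k (\<lambda>v. \<alpha> v + (-1) * \<beta> v)"
    by (intro is_form_add is_form_mult assms)
  then show ?thesis by simp
qed

text \<open>Freezing the trailing arguments turns the volume form into a k-form, which can then be
  compared with a single monomial.\<close>

lemma is_form_fix_slots:
  assumes \<alpha>: "is_form n \<alpha>" and k: "k \<le> n"
  shows "is_form k (\<lambda>v. \<alpha> (\<lambda>i. if i < k then v i else w i))"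
  unfolding is_form_def
proof (intro conjI allI impI)
  fix v v' :: "nat \<Rightarrow> 'a" assume "\<forall>i<k. v i = v' i"
  then show "\<alpha> (\<lambda>i. if i < k then v i else w i) = \<alpha> (\<lambda>i. if i < k then v' i else w i)"
    by (intro is_form_cong[OF \<alpha>]) simp
next
  fix v :: "nat \<Rightarrow> 'a" and i assume i: "i < k"
  have "(\<lambda>m. if m < k then (v(i := x)) m else w m) = (\<lambda>m. if m < k then v m else w m)(i := x)" for x
    using i by auto
  then show "linear (\<lambda>x. \<alpha> (\<lambda>m. if m < k then (v(i := x)) m else w m))"
    using is_form_linear[OF \<alpha>, of i] i k by simp
next
  fix v :: "nat \<Rightarrow> 'a" and i j assume "i < k" "j < k" "i \<noteq> j \<and> v i = v j"
  then show "\<alpha> (\<lambda>i. if i < k then v i else w i) = 0"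
    using k by (intro is_form_eq_0[OF \<alpha>, of i j]) auto
qed

text \<open>Sorting the indices by transpositions decreases \<open>\<Sum>i<k. (k - i) * K i\<close>.\<close>

lemma form_eq_0_on_frame:
  assumes \<alpha>: "is_form k \<alpha>"
    and inc: "\<And>K. (\<And>i. i < k \<Longrightarrow> K i \<in> S) \<Longrightarrow> (\<And>i j. i < j \<Longrightarrow> j < k \<Longrightarrow> K i < K j) \<Longrightarrow> \<alpha> (\<lambda>i. B (K i)) = 0"
    and K: "\<And>i. i < k \<Longrightarrow> K i \<in> (S :: nat set)"
  shows "\<alpha> (\<lambda>i. B (K i)) = 0"
  using K
proof (induction "\<Sum>i<k. (k - i) * K i" arbitrary: K rule: less_induct)
  case less
  show ?case
  proof (cases "\<forall>i j. i < j \<longrightarrow> j < k \<longrightarrow> K i < K j")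
    case True
    then show ?thesis using inc less.prems by blast
  next
    case False
    then obtain i j where ij: "i < j" "j < k" "K j \<le> K i" by (meson not_less)
    show ?thesis
    proof (cases "K i = K j")
      case True
      then show ?thesis using ij by (intro is_form_eq_0[OF \<alpha>, of i j]) auto
    next
      case False
      define L where "L = (\<lambda>m. K (Transposition.transpose i j m))"
      have L: "L i = K j" "L j = K i" "\<And>m. m \<noteq> i \<Longrightarrow> m \<noteq> j \<Longrightarrow> L m = K m"
        by (auto simp: L_def Transposition.transpose_def)
      have split: "(\<Sum>m<k. (k - m) * M m) =
          (k - i) * M i + ((k - j) * M j + (\<Sum>m\<in>{..<k} - {i} - {j}. (k - m) * M m))" for M :: "nat \<Rightarrow> nat"
      proof -
        have "(\<Sum>m<k. (k - m) * M m) = (k - i) * M i + (\<Sum>m\<in>{..<k} - {i}. (k - m) * M m)"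
          using ij by (intro sum.remove) auto
        also have "(\<Sum>m\<in>{..<k} - {i}. (k - m) * M m) =
            (k - j) * M j + (\<Sum>m\<in>{..<k} - {i} - {j}. (k - m) * M m)"
          using ij by (intro sum.remove) auto
        finally show ?thesis .
      qed
      \<comment> \<open>Writing both gaps as successors avoids truncated subtraction: the sum drops
        by (c + 1) * (d + 1).\<close>
      have "k - j < k - i" using ij by simp
      then obtain c where c: "k - i = (k - j) + Suc c"
        using less_imp_Suc_add[of "k - j" "k - i"] by (metis add_Suc_right)
      obtain d where d: "K i = K j + Suc d"
        using ij False less_imp_Suc_add[of "K j" "K i"] by auto
      have "(\<Sum>m\<in>{..<k} - {i} - {j}. (k - m) * L m) = (\<Sum>m\<in>{..<k} - {i} - {j}. (k - m) * K m)"
        by (intro sum.cong) (auto simp: L)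
      then have "(\<Sum>m<k. (k - m) * L m) < (\<Sum>m<k. (k - m) * K m)"
        unfolding split[of L] split[of K] L c d by (simp add: algebra_simps)
      moreover have "L m \<in> S" if "m < k" for m
        using less.prems that ij by (cases "m = i"; cases "m = j") (auto simp: L)
      ultimately have "\<alpha> (\<lambda>m. B (L m)) = 0" by (rule less.hyps)
      moreover have "\<alpha> (\<lambda>m. B (L m)) = - \<alpha> (\<lambda>m. B (K m))"
        unfolding L_def using is_form_swap[OF \<alpha>, of i j "\<lambda>m. B (K m)"] ij by simp
      ultimately show ?thesis by simp
    qed
  qed
qed

text \<open>By multilinearity the expansion in B is inserted slot by slot until only values on frame
  vectors remain; sorting reduces these to increasing index sequences.\<close>

lemma form_eq_0I:
  assumes \<alpha>: "is_form k \<alpha>" and S: "\<And>x. x = (\<Sum>i\<in>(S :: nat set). \<theta> i x *\<^sub>R B i)"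
    and inc: "\<And>K. (\<And>i. i < k \<Longrightarrow> K i \<in> S) \<Longrightarrow> (\<And>i j. i < j \<Longrightarrow> j < k \<Longrightarrow> K i < K j) \<Longrightarrow> \<alpha> (\<lambda>i. B (K i)) = 0"
  shows "\<alpha> v = 0"
proof -
  \<comment> \<open>Slots below m are still arbitrary; those from m on already hold frame
    vectors.\<close>
  have *: "\<alpha> v = 0" if "m \<le> k" "\<And>i. m \<le> i \<Longrightarrow> i < k \<Longrightarrow> v i \<in> B ` (S :: nat set)" for m v
    using that
  proof (induction m arbitrary: v)
    case 0
    have "\<forall>i. \<exists>j. i < k \<longrightarrow> j \<in> S \<and> v i = B j"
      using 0(2) by blast
    then obtain K where K: "\<And>i. i < k \<Longrightarrow> K i \<in> S" "\<And>i. i < k \<Longrightarrow> v i = B (K i)"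
      by metis
    have "\<alpha> v = \<alpha> (\<lambda>i. B (K i))" by (rule is_form_cong[OF \<alpha>]) (rule K(2))
    also have "\<dots> = 0"
      by (rule form_eq_0_on_frame[OF \<alpha>, where S = S]) (fact inc, fact K(1))
    finally show ?case .
  next
    case (Suc m)
    have m: "m < k" using Suc by simp
    have lin: "linear (\<lambda>x. \<alpha> (v(m := x)))" by (rule is_form_linear[OF \<alpha> m])
    have "\<alpha> v = \<alpha> (v(m := (\<Sum>i\<in>S. \<theta> i (v m) *\<^sub>R B i)))"
      unfolding S[of "v m", symmetric] by simp
    also have "\<dots> = (\<Sum>i\<in>S. \<theta> i (v m) * \<alpha> (v(m := B i)))"
      by (simp add: linear_sum[OF lin] linear_scale[OF lin])
    also have "\<dots> = 0"
    proof (intro sum.neutral ballI)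
      fix i assume "i \<in> S"
      have "\<alpha> (v(m := B i)) = 0"
        using m \<open>i \<in> S\<close> Suc.prems by (intro Suc.IH) auto
      then show "\<theta> i (v m) * \<alpha> (v(m := B i)) = 0" by simp
    qed
    finally show ?case .
  qed
  show ?thesis by (rule *[of k]) simp_all
qed

section \<open>Linear combinations of monomials\<close>

definition lincomb :: "(nat \<Rightarrow> 'v \<Rightarrow> real) \<Rightarrow> (real \<times> nat list) list \<Rightarrow> 'v form" where
  "lincomb f L = (\<lambda>v. \<Sum>(c, I)\<leftarrow>L. c * monomial f I v)"

lemma lincomb_Nil: "lincomb f [] = (\<lambda>v. 0)"
  and lincomb_Cons: "lincomb f ((c, I) # L) = (\<lambda>v. c * monomial f I v + lincomb f L v)"
  and lincomb_append: "lincomb f (L @ M) = (\<lambda>v. lincomb f L v + lincomb f M v)"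
  by (simp_all add: lincomb_def)

lemma is_form_lincomb:
  assumes "\<forall>(c, I)\<in>set L. length I = k \<and> (\<forall>i\<in>set I. linear (f i))"
  shows "is_form k (lincomb f L)"
  using assms
proof (induction L)
  case (Cons x L)
  obtain c I where "x = (c, I)" by force
  with Cons show ?case
    using is_form_monomial[of I f] by (auto simp: lincomb_Cons intro!: is_form_add is_form_mult)
qed (simp add: lincomb_Nil is_form_0)

lemma wedge_0_left: "wedge p q (\<lambda>v. 0) \<beta> = (\<lambda>v. 0)"
  and wedge_0_right: "wedge p q \<beta> (\<lambda>v. 0) = (\<lambda>v. 0)"
  by (simp_all add: wedge_def)

lemma wedge_mult_left: "wedge p q (\<lambda>v. c * \<alpha> v) \<beta> = (\<lambda>v. c * wedge p q \<alpha> \<beta> v)"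
  and wedge_mult_right: "wedge p q \<alpha> (\<lambda>v. c * \<beta> v) = (\<lambda>v. c * wedge p q \<alpha> \<beta> v)"
  by (simp_all add: wedge_def sum_distrib_left mult_ac)

lemma wedge_add_left: "wedge p q (\<lambda>v. \<alpha> v + \<alpha>' v) \<beta> = (\<lambda>v. wedge p q \<alpha> \<beta> v + wedge p q \<alpha>' \<beta> v)"
  and wedge_add_right: "wedge p q \<beta> (\<lambda>v. \<alpha> v + \<alpha>' v) = (\<lambda>v. wedge p q \<beta> \<alpha> v + wedge p q \<beta> \<alpha>' v)"
  by (simp_all add: wedge_def algebra_simps sum.distrib add_divide_distrib)

definition list_wedge :: "(real \<times> nat list) list \<Rightarrow> (real \<times> nat list) list \<Rightarrow> (real \<times> nat list) list" where
  "list_wedge L M = concat (map (\<lambda>(c, I). map (\<lambda>(d, J). (c * d, I @ J)) M) L)"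

lemma wedge_lincomb:
  assumes L: "\<forall>(c, I)\<in>set L. length I = p" and M: "\<forall>(d, J)\<in>set M. length J = q"
  shows "wedge p q (lincomb f L) (lincomb f M) = lincomb f (list_wedge L M)"
proof -
  have row: "wedge p q (monomial f I) (lincomb f M) v = lincomb f (map (\<lambda>(d, J). (d, I @ J)) M) v"
    if "length I = p" for I v
    using M
  proof (induction M)
    case (Cons x M)
    obtain d J where x: "x = (d, J)" by force
    with Cons have "wedge p q (monomial f I) (monomial f J) = monomial f (I @ J)"
      using wedge_monomial[of I J f] that by simp
    with Cons x show ?case
      by (simp add: lincomb_Cons wedge_add_right wedge_mult_right)
  qed (simp add: lincomb_Nil wedge_0_right)
  have scale: "c * lincomb f M v = lincomb f (map (\<lambda>(d, J). (c * d, J)) M) v" for c and M :: "(real \<times> nat list) list" and v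
    by (induction M) (auto simp: lincomb_Nil lincomb_Cons algebra_simps)
  have "wedge p q (lincomb f L) (lincomb f M) v = lincomb f (list_wedge L M) v" for v
    using L
  proof (induction L)
    case (Cons x L)
    obtain c I where x: "x = (c, I)" by force
    have "c * lincomb f (map (\<lambda>(d, J). (d, I @ J)) M) v = lincomb f (map (\<lambda>(d, J). (c * d, I @ J)) M) v"
      unfolding scale by (simp add: case_prod_unfold comp_def)
    with Cons x show ?case
      by (simp add: lincomb_Cons list_wedge_def lincomb_append wedge_add_left wedge_mult_left row)
  qed (simp add: lincomb_Nil list_wedge_def wedge_0_left)
  then show ?thesis by (rule ext)
qed

section \<open>Sorting the indices of a monomial\<close>

lemma monomial_pair: "monomial f [a, b] v = f a (v 0) * f b (v 1) - f a (v 1) * f b (v 0)"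
proof -
  have "{\<sigma>. \<sigma> permutes {..<2 :: nat}} = {id, Transposition.transpose 0 1}"
    by (auto simp: lessThan_Suc numeral_2_eq_2 permutes_doubleton_iff insert_commute)
  moreover have "Transposition.transpose 0 (1 :: nat) \<noteq> id"
    by (metis id_apply transpose_apply_first zero_neq_one)
  ultimately show ?thesis
    by (simp add: monomial_alternate alternate_def sign_swap_id numeral_2_eq_2)
qed

text \<open>\<open>wedge_monomial\<close> splits off the two leading indices, and a 2 by 2
  determinant changes sign with its rows.\<close>

lemma monomial_swap: "monomial f (a # b # J) v = - monomial f (b # a # J) v"
proof -
  have "monomial f [a, b] = (\<lambda>v. (-1) * monomial f [b, a] v)"
    by (simp add: monomial_pair fun_eq_iff)
  then have "monomial f ([a, b] @ J) = (\<lambda>v. (-1) * monomial f ([b, a] @ J) v)"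
    unfolding wedge_monomial[symmetric] by (simp only: wedge_mult_left list.size)
  then show ?thesis by simp
qed

lemma monomial_repeat: "monomial f (a # a # J) v = 0"
  using monomial_swap[of f a a J v] by simp

text \<open>One sign change for each index that \<open>a\<close> passes, and 0 when it meets itself.
  The recursion follows \<open>insort\<close>, as that of \<open>list_sign\<close> follows
  \<open>sort\<close>, so concrete index lists are evaluated by rewriting.\<close>

fun insert_sign :: "nat \<Rightarrow> nat list \<Rightarrow> real" where
  "insert_sign a [] = 1"
| "insert_sign a (b # J) = (if a < b then 1 else if a = b then 0 else - insert_sign a J)"

fun list_sign :: "nat list \<Rightarrow> real" where
  "list_sign [] = 1"
| "list_sign (a # I) = list_sign I * insert_sign a (sort I)"

lemma monomial_insort: "monomial f (a # J) v = insert_sign a J * monomial f (insort a J) v"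
proof (induction J arbitrary: v)
  case (Cons b J)
  show ?case
  proof (cases "b < a")
    case True
    have "monomial f (a # J) = (\<lambda>v. insert_sign a J * monomial f (insort a J) v)"
      using Cons by (rule ext)
    then have "monomial f (b # a # J) v = insert_sign a J * monomial f (b # insort a J) v"
      by (simp add: monomial.simps(2)[of f b] wedge_mult_right)
    then show ?thesis using True monomial_swap[of f a b J v] by simp
  qed (auto simp: monomial_repeat)
qed simp

lemma monomial_sort: "monomial f I = (\<lambda>v. list_sign I * monomial f (sort I) v)"
proof (induction I)
  case (Cons a I)
  have "monomial f (a # I) v = list_sign I * monomial f (a # sort I) v" for v
    by (subst monomial.simps(2), subst Cons) (simp add: monomial.simps(2) wedge_mult_right)
  then show ?case by (simp add: monomial_insort[of f a "sort I"] fun_eq_iff)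
qed simp

text \<open>Terms with a repeated index stay with coefficient 0, and equal index lists are not
  merged; the simplification that closes each computation collects them.\<close>

definition list_normal :: "(real \<times> nat list) list \<Rightarrow> (real \<times> nat list) list" where
  "list_normal L = map (\<lambda>(c, I). (c * list_sign I, sort I)) L"

lemma lincomb_normal: "lincomb f (list_normal L) = lincomb f L"
proof
  fix v show "lincomb f (list_normal L) v = lincomb f L v"
  proof (induction L)
    case (Cons x L)
    obtain c I where "x = (c, I)" by force
    moreover have "monomial f I v = list_sign I * monomial f (sort I) v"
      using fun_cong[OF monomial_sort] .
    ultimately show ?case using Cons by (simp add: lincomb_Cons list_normal_def)
  qed (simp add: list_normal_def)
qed

section \<open>Dual frames and the Hodge operator\<close>

text \<open>The vector dual to the first form is killed by all later ones, so the expansion has a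
  single term and the factors of I are peeled off in turn.\<close>

lemma monomial_contract_frame:
  assumes "\<And>i. i \<in> set (I @ J) \<Longrightarrow> linear (f i)" "distinct (I @ J)"
    and "\<And>i j. i \<in> set I \<Longrightarrow> j \<in> set (I @ J) \<Longrightarrow> f j (B i) = (if i = j then 1 else 0)"
  shows "monomial f (I @ J) (\<lambda>i. if i < length I then B (I ! i) else w (i - length I)) = monomial f J w"
  using assms
proof (induction I)
  case (Cons a I)
  let ?v = "\<lambda>i. if i < length (a # I) then B ((a # I) ! i) else w (i - length (a # I))"
  have "monomial f (a # (I @ J)) ?v = f a (?v 0) * monomial f (I @ J) (\<lambda>i. ?v (Suc i))"
    using Cons.prems by (intro monomial_contract) auto
  also have "(\<lambda>i. ?v (Suc i)) = (\<lambda>i. if i < length I then B (I ! i) else w (i - length I))"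
    by auto
  also have "monomial f (I @ J) \<dots> = monomial f J w"
    using Cons.prems by (intro Cons.IH) auto
  finally show ?case using Cons.prems by simp
qed simp

lemma monomial_frame:
  assumes "\<And>i. i \<in> set I \<Longrightarrow> linear (f i)" "distinct I"
    and "\<And>i j. i \<in> set I \<Longrightarrow> j \<in> set I \<Longrightarrow> f j (B i) = (if i = j then 1 else 0)"
  shows "monomial f I (\<lambda>i. B (I ! i)) = 1"
proof -
  have "monomial f I (\<lambda>i. B (I ! i)) = monomial f (I @ []) (\<lambda>i. if i < length I then B (I ! i) else undefined (i - length I))"
    unfolding append_Nil2 by (rule monomial_args_cong) simp
  also have "\<dots> = 1"
    using assms by (subst monomial_contract_frame) auto
  finally show ?thesis .
qed

definition coframe_metric :: "(nat \<Rightarrow> 'v \<Rightarrow> real) \<Rightarrow> 'v \<Rightarrow> 'v \<Rightarrow> real" where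
  "coframe_metric f = (\<lambda>x y. \<Sum>i=1..8. f i x * f i y)"

definition coframe_volume :: "(nat \<Rightarrow> 'v \<Rightarrow> real) \<Rightarrow> 'v form" where
  "coframe_volume f = monomial f [1,2,3,4,5,6,7,8]"

definition complement :: "nat list \<Rightarrow> nat list" where
  "complement I = [x \<leftarrow> [1,2,3,4,5,6,7,8]. x \<notin> set I]"

text \<open>For distinct indices between 1 and 8 the sign makes the wedge of a monomial with its
  image equal to the volume form.\<close>

definition list_hodge :: "(real \<times> nat list) list \<Rightarrow> (real \<times> nat list) list" where
  "list_hodge L = map (\<lambda>(c, I). (c * list_sign (I @ complement I), complement I)) L"

lemma indices8: "{1..8} = set [1,2,3,4,5,6,7,8 :: nat]"
  by (rule set_eqI) (simp, presburger)

lemma set_complement: "set (complement I) = {1..8} - set I"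
  by (simp only: complement_def indices8 set_filter set_diff_eq mem_Collect_eq)

lemma distinct_complement: "distinct (complement I)"
  unfolding complement_def by (rule distinct_filter) simp

text \<open>The vectors B are carried along with the coframe because \<open>'v\<close> is an
  arbitrary real vector space; \<open>expand\<close> supplies its finite dimension.\<close>

locale dual_frame =
  fixes f :: "nat \<Rightarrow> 'v::real_vector \<Rightarrow> real" and B :: "nat \<Rightarrow> 'v"
  assumes lin: "i \<in> {1..8} \<Longrightarrow> linear (f i)"
    and dual: "i \<in> {1..8} \<Longrightarrow> j \<in> {1..8} \<Longrightarrow> f i (B j) = (if i = j then 1 else 0)"
    and expand: "x = (\<Sum>i\<in>{1..8}. f i x *\<^sub>R B i)"
begin

lemma frame_eqI: "(\<And>i. i \<in> {1..8} \<Longrightarrow> f i x = f i y) \<Longrightarrow> x = y"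
  by (subst expand[of x], subst expand[of y]) simp

lemma metric_frame: "i \<in> {1..8} \<Longrightarrow> coframe_metric f (B i) x = f i x"
  unfolding coframe_metric_def using dual by (simp add: if_distrib[of "\<lambda>x. x * _"] cong: if_cong)

lemma metric_commute: "coframe_metric f x y = coframe_metric f y x"
  by (simp add: coframe_metric_def mult.commute)

lemma linear_metric: "linear (coframe_metric f x)"
  unfolding coframe_metric_def
  by (intro linear_compose_sum ballI linear_mult_const_left lin)

lemma inner_product_metric: "inner_product (coframe_metric f)"
  unfolding inner_product_def
proof (intro conjI allI impI linear_metric metric_commute)
  fix x :: 'v assume "x \<noteq> 0"
  then obtain i where i: "i \<in> {1..8}" "f i x \<noteq> 0"
    using frame_eqI[of x 0] lin linear_0 by metis
  have "f i x * f i x > 0" using i(2) not_real_square_gt_zero[of "f i x"] by blast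
  with i show "coframe_metric f x x > 0"
    unfolding coframe_metric_def by (intro sum_pos2[of _ i]) auto
qed

text \<open>Orthonormal vectors are independent, and the spanning family B bounds independent sets
  by 8 elements; a vector outside the span of b would make nine.\<close>

lemma orthonormal_expand:
  fixes b :: "nat \<Rightarrow> 'v"
  assumes on: "\<And>i j. i < 8 \<Longrightarrow> j < 8 \<Longrightarrow> coframe_metric f (b i) (b j) = (if i = j then 1 else 0)"
  shows "x = (\<Sum>i\<in>{..<8}. coframe_metric f (b i) x *\<^sub>R b i)"
proof -
  interpret g: linear "coframe_metric f y" for y by (rule linear_metric)
  have coef: "coframe_metric f (b j) (\<Sum>i<8. c i *\<^sub>R b i) = c j" if "j < 8" for c j
    using that on by (simp add: g.sum g.scale if_distrib[of "\<lambda>x. _ * x"] cong: if_cong)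
  have inj: "inj_on b {..<8}"
  proof (rule inj_onI)
    fix i j assume "i \<in> {..<8}" "j \<in> {..<8}" "b i = b j"
    then show "i = j" using on[of i j] on[of i i] by (simp split: if_splits)
  qed
  have ind: "independent (b ` {..<8})"
  proof (rule independent_if_scalars_zero)
    fix u y assume u: "(\<Sum>z\<in>b ` {..<8}. u z *\<^sub>R z) = 0" and "y \<in> b ` {..<8}"
    then obtain j where j: "j < 8" "y = b j" by auto
    have "(\<Sum>i<8. u (b i) *\<^sub>R b i) = 0" using u by (simp add: sum.reindex[OF inj])
    then show "u y = 0" using coef[OF j(1), of "\<lambda>i. u (b i)"] j by (simp add: g.zero)
  qed simp
  have span: "x \<in> span (B ` {1..8})" for x
    by (subst expand[of x]) (intro span_sum span_scale span_base imageI)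
  have "x \<in> span (b ` {..<8})"
  proof (rule ccontr)
    assume x: "x \<notin> span (b ` {..<8})"
    then have "independent (insert x (b ` {..<8}))"
      using ind by (simp add: independent_insert)
    then have "card (insert x (b ` {..<8})) \<le> card (B ` {1..8})"
      using independent_span_bound[of "B ` {1..8}" "insert x (b ` {..<8})"] span by auto
    moreover have "x \<notin> b ` {..<8}" using x by (metis span_base)
    ultimately show False
      using card_image_le[of "{1..8}" B] by (simp add: card_image[OF inj])
  qed
  then obtain u where u: "x = (\<Sum>z\<in>b ` {..<8}. u z *\<^sub>R z)"
    by (auto simp: span_finite)
  then have x: "x = (\<Sum>i<8. u (b i) *\<^sub>R b i)" by (simp add: sum.reindex[OF inj])
  have "coframe_metric f (b i) x = u (b i)" if "i < 8" for i
    unfolding x by (rule coef[OF that])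
  then have "(\<Sum>i<8. coframe_metric f (b i) x *\<^sub>R b i) = (\<Sum>i<8. u (b i) *\<^sub>R b i)"
    by (intro sum.cong) auto
  also have "\<dots> = x" by (rule x[symmetric])
  finally show ?thesis by (rule sym)
qed

lemma is_form_volume: "is_form 8 (coframe_volume f)"
proof -
  have len: "length [1,2,3,4,5,6,7,8 :: nat] = 8" by simp
  show ?thesis
    unfolding coframe_volume_def
    by (rule is_form_monomial[of "[1,2,3,4,5,6,7,8]" f, unfolded len]) (use lin in auto)
qed

text \<open>Both sides are k-forms in v, so it suffices to compare them on the vectors of b
  itself.\<close>

lemma volume_fix_slots:
  assumes on: "\<And>i j. i < 8 \<Longrightarrow> j < 8 \<Longrightarrow> coframe_metric f (b i) (b j) = (if i = j then 1 else 0)"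
    and k: "k \<le> 8"
  shows "coframe_volume f (\<lambda>i. if i < k then v i else b i) =
    coframe_volume f b * monomial (\<lambda>m. coframe_metric f (b m)) [0..<k] v"
proof -
  let ?\<theta> = "\<lambda>m. coframe_metric f (b m)"
  let ?h = "\<lambda>v. coframe_volume f (\<lambda>i. if i < k then v i else b i)"
  let ?m = "\<lambda>v. coframe_volume f b * monomial ?\<theta> [0..<k] v"
  have h: "is_form k ?h" by (rule is_form_fix_slots[OF is_form_volume k])
  have mono: "is_form k (monomial ?\<theta> [0..<k])"
    using is_form_monomial[of "[0..<k]" ?\<theta>] linear_metric by simp
  have mb: "monomial ?\<theta> [0..<k] b = 1"
  proof -
    have "monomial ?\<theta> [0..<k] b = monomial ?\<theta> [0..<k] (\<lambda>i. b ([0..<k] ! i))"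
      by (rule monomial_args_cong) simp
    also have "\<dots> = 1"
      using on k linear_metric by (intro monomial_frame) auto
    finally show ?thesis .
  qed
  have "?h v - ?m v = 0"
  proof (rule form_eq_0I[where \<alpha> = "\<lambda>v. ?h v - ?m v" and S = "{..<8}" and \<theta> = ?\<theta> and B = b])
    show "is_form k (\<lambda>v. ?h v - ?m v)" by (intro is_form_diff h is_form_mult mono)
    show "x = (\<Sum>i\<in>{..<8}. coframe_metric f (b i) x *\<^sub>R b i)" for x
      by (rule orthonormal_expand[OF on])
  next
    fix K :: "nat \<Rightarrow> nat"
    assume K: "\<And>i. i < k \<Longrightarrow> K i \<in> {..<8}" and inc: "\<And>i j. i < j \<Longrightarrow> j < k \<Longrightarrow> K i < K j"
    have inj: "inj_on K {..<k}"
      using inc by (intro inj_onI) (metis lessThan_iff less_irrefl linorder_neqE_nat)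
    show "?h (\<lambda>i. b (K i)) - ?m (\<lambda>i. b (K i)) = 0"
    proof (cases "\<forall>i<k. K i < k")
      case True
      define p where "p i = (if i < k then K i else i)" for i
      have "bij_betw K {..<k} {..<k}"
        using True inj endo_inj_surj[of "{..<k}" K] by (auto simp: bij_betw_def image_subset_iff)
      then have "bij_betw p {..<k} {..<k}"
        by (subst bij_betw_cong[of _ _ K]) (auto simp: p_def)
      then have p: "p permutes {..<k}"
        by (rule bij_imp_permutes) (simp add: p_def)
      have e: "?h (\<lambda>i. b (K i)) = ?h (\<lambda>i. b (p i))"
        "monomial ?\<theta> [0..<k] (\<lambda>i. b (K i)) = monomial ?\<theta> [0..<k] (\<lambda>i. b (p i))"
        by (rule is_form_cong[OF h], simp add: p_def, rule is_form_cong[OF mono], simp add: p_def)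
      have "(\<lambda>i. if i < k then b i else b i) = b" by auto
      then show ?thesis
        unfolding e is_form_permute[OF h p, of b] is_form_permute[OF mono p, of b] mb by simp
    next
      case False
      then obtain i where i: "i < k" "\<not> K i < k" by auto
      with K[OF i(1)] have "K i < 8" by simp
      have "monomial ?\<theta> [0..<k] (\<lambda>i. b (K i)) = 0"
        using i \<open>K i < 8\<close> on k by (intro monomial_eq_0[of i]) auto
      moreover have "?h (\<lambda>i. b (K i)) = 0"
        using i \<open>K i < 8\<close> k by (intro is_form_eq_0[OF is_form_volume, of i "K i"]) auto
      ultimately show ?thesis by simp
    qed
  qed
  then show ?thesis by simp
qed

text \<open>The volume 1 of B is rewritten through b by \<open>volume_fix_slots\<close> with all
  eight slots replaced. The determinant that appears is the transpose of the one defining the volume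
  of b, which produces the square.\<close>

lemma volume_orthonormal:
  assumes on: "\<And>i j. i < 8 \<Longrightarrow> j < 8 \<Longrightarrow> coframe_metric f (b i) (b j) = (if i = j then 1 else 0)"
  shows "coframe_volume f b * coframe_volume f b = 1"
proof -
  let ?I = "[1,2,3,4,5,6,7,8 :: nat]"
  have nth: "?I ! i = Suc i" if "i < 8" for i
    using that by (auto simp: numeral_eq_Suc less_Suc_eq)
  have "1 = coframe_volume f (\<lambda>i. B (?I ! i))"
    unfolding coframe_volume_def using lin dual by (intro monomial_frame[symmetric]) auto
  also have "\<dots> = coframe_volume f (\<lambda>i. if i < 8 then B (?I ! i) else b i)"
    by (rule is_form_cong[OF is_form_volume]) simp
  also have "\<dots> = coframe_volume f b * monomial (\<lambda>m. coframe_metric f (b m)) [0..<8] (\<lambda>i. B (?I ! i))"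
    by (rule volume_fix_slots[OF on]) simp_all
  also have "monomial (\<lambda>m. coframe_metric f (b m)) [0..<8] (\<lambda>i. B (?I ! i)) = coframe_volume f b"
    unfolding coframe_volume_def
  proof (rule monomial_transpose)
    fix i j assume "i < length [0..<8]" "j < length ?I"
    then have "j < 8" "i < 8" by simp_all
    then show "coframe_metric f (b ([0..<8] ! i)) (B (?I ! j)) = f (?I ! j) (b i)"
      unfolding nth[OF \<open>j < 8\<close>] by (simp add: metric_frame metric_commute[of "b _"])
  qed simp
  finally show ?thesis by simp
qed

text \<open>A case of Jacobi's theorem on complementary minors of an orthogonal matrix.\<close>

lemma monomial_complement:
  assumes on: "\<And>i j. i < 8 \<Longrightarrow> j < 8 \<Longrightarrow> coframe_metric f (b i) (b j) = (if i = j then 1 else 0)"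
    and IJ: "distinct (I @ J)" "sort (I @ J) = [1,2,3,4,5,6,7,8]"
  shows "monomial f J (\<lambda>i. b (length I + i)) = list_sign (I @ J) * coframe_volume f b * monomial f I b"
proof -
  let ?k = "length I"
  let ?v = "\<lambda>i. if i < ?k then B (I ! i) else b i"
  have set: "set (I @ J) = {1..8}" unfolding indices8 IJ(2)[symmetric] by simp
  then have sub: "set I \<subseteq> {1..8}" "set J \<subseteq> {1..8}" by auto
  have len: "length (I @ J) = 8" using arg_cong[OF IJ(2), of length] by simp
  \<comment> \<open>Vectors dual to I in the leading slots complete the minor for J to a full 8 by 8
    determinant, to which \<open>volume_fix_slots\<close> applies.\<close>
  have "monomial f J (\<lambda>i. b (?k + i)) =
      monomial f (I @ J) (\<lambda>i. if i < ?k then B (I ! i) else b (?k + (i - ?k)))"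
    by (intro monomial_contract_frame[symmetric]) (use sub lin dual IJ in \<open>auto simp: subset_iff\<close>)
  also have "(\<lambda>i. if i < ?k then B (I ! i) else b (?k + (i - ?k))) = ?v" by auto
  also have "monomial f (I @ J) ?v = list_sign (I @ J) * coframe_volume f ?v"
    using fun_cong[OF monomial_sort[of f "I @ J"]] by (simp add: IJ(2) coframe_volume_def)
  also have "coframe_volume f ?v = coframe_volume f b * monomial (\<lambda>m. coframe_metric f (b m)) [0..<?k] (\<lambda>i. B (I ! i))"
    using len by (intro volume_fix_slots[OF on, of ?k "\<lambda>i. B (I ! i)"]) auto
  also have "monomial (\<lambda>m. coframe_metric f (b m)) [0..<?k] (\<lambda>i. B (I ! i)) = monomial f I b"
  proof (rule monomial_transpose)
    fix i j assume "i < length [0..<?k]" "j < length I"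
    moreover from this have "I ! j \<in> {1..8}" using set nth_mem[of j I] by auto
    ultimately show "coframe_metric f (b ([0..<?k] ! i)) (B (I ! j)) = f (I ! j) (b i)"
      by (simp add: metric_frame metric_commute[of "b _"])
  qed simp
  finally show ?thesis by simp
qed

text \<open>Obtained by evaluation instead of combinatorics: on the frame in the order I @ J the
  sign times the volume is 1, and the volume of an orthonormal basis squares to 1.\<close>

lemma list_sign_square:
  assumes IJ: "distinct (I @ J)" "sort (I @ J) = [1,2,3,4,5,6,7,8]"
  shows "list_sign (I @ J) * list_sign (I @ J) = 1"
proof -
  let ?b = "\<lambda>i. B ((I @ J) ! i)"
  have set: "set (I @ J) = {1..8}" unfolding indices8 IJ(2)[symmetric] by simp
  then have sub: "set I \<subseteq> {1..8}" "set J \<subseteq> {1..8}" by auto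
  have len: "length (I @ J) = 8" using arg_cong[OF IJ(2), of length] by simp
  have mem: "(I @ J) ! i \<in> {1..8}" if "i < 8" for i
    using that nth_mem[of i "I @ J"] len set by metis
  have "coframe_metric f (?b i) (?b j) = (if i = j then 1 else 0)" if "i < 8" "j < 8" for i j
    using that mem[of i] mem[of j] dual len IJ(1) by (simp add: metric_frame nth_eq_iff_index_eq)
  then have v: "coframe_volume f ?b * coframe_volume f ?b = 1" by (rule volume_orthonormal)
  have "1 = monomial f (I @ J) ?b"
    by (intro monomial_frame[symmetric]) (use sub lin dual IJ in \<open>auto simp: subset_iff\<close>)
  also have "\<dots> = list_sign (I @ J) * coframe_volume f ?b"
    using fun_cong[OF monomial_sort[of f "I @ J"]] by (simp add: IJ(2) coframe_volume_def)
  finally have "1 * 1 = (list_sign (I @ J) * coframe_volume f ?b) * (list_sign (I @ J) * coframe_volume f ?b)"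
    by simp
  then show ?thesis using v by (simp add: algebra_simps)
qed

text \<open>Every increasing index list is the tail of a reordering of the orthonormal frame B; only
  the orientation may need correction.\<close>

lemma form_eq_0_on_oriented_onb:
  assumes \<alpha>: "is_form m \<alpha>" and k: "1 \<le> k" "k + m = 8"
    and onb: "\<And>b. oriented_onb (coframe_metric f) (coframe_volume f) b \<Longrightarrow> \<alpha> (\<lambda>i. b (k + i)) = 0"
  shows "\<alpha> = (\<lambda>v. 0)"
proof
  fix v show "\<alpha> v = 0"
  proof (rule form_eq_0I[OF \<alpha> expand])
    fix K :: "nat \<Rightarrow> nat"
    assume K: "\<And>i. i < m \<Longrightarrow> K i \<in> {1..8}" and inc: "\<And>i j. i < j \<Longrightarrow> j < m \<Longrightarrow> K i < K j"
    have inj: "inj_on K {..<m}"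
      using inc by (intro inj_onI) (metis lessThan_iff less_irrefl linorder_neqE_nat)
    define J where "J = map K [0..<m]"
    define I where "I = complement J"
    have J: "distinct J" "set J \<subseteq> {1..8}" "length J = m"
      using K inj by (auto simp: J_def distinct_map atLeast0LessThan)
    have I: "distinct I" "set I = {1..8} - set J"
      unfolding I_def by (rule distinct_complement, rule set_complement)
    have "length I = card ({1..8} - set J)" using distinct_card[OF I(1)] I(2) by simp
    also have "\<dots> = k"
      using card_Diff_subset[of "set J" "{1..8}"] J k by (simp add: distinct_card)
    finally have lenI: "length I = k" .
    have dist: "distinct (I @ J)" and len: "length (I @ J) = 8" and set: "set (I @ J) = {1..8}"
      using I J lenI k by auto
    define b where "b = (\<lambda>i. B ((I @ J) ! i))"
    have mem: "(I @ J) ! i \<in> {1..8}" if "i < 8" for i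
      using that nth_mem[of i "I @ J"] len set by metis
    have on: "coframe_metric f (b i) (b j) = (if i = j then 1 else 0)" if "i < 8" "j < 8" for i j
      using that mem[of i] mem[of j] dual len dist by (simp add: b_def metric_frame nth_eq_iff_index_eq)
    interpret g: linear "coframe_metric f y" for y by (rule linear_metric)
    have tail: "b (k + i) = B (K i)" if "i < m" for i
      using that lenI by (simp add: b_def nth_append J_def)
    show "\<alpha> (\<lambda>i. B (K i)) = 0"
    proof (cases "coframe_volume f b > 0")
      case True
      then have "\<alpha> (\<lambda>i. b (k + i)) = 0"
        using on by (intro onb) (simp add: oriented_onb_def)
      moreover have "\<alpha> (\<lambda>i. b (k + i)) = \<alpha> (\<lambda>i. B (K i))"
        by (rule is_form_cong[OF \<alpha>]) (rule tail)
      ultimately show ?thesis by simp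
    next
      case False
      \<comment> \<open>Slot 0 lies before the tail because 1 \<le> k, so reversing
        \<open>b 0\<close> changes the orientation and leaves the arguments of \<alpha>
        alone.\<close>
      define b' where "b' = b(0 := - b 0)"
      interpret v: linear "\<lambda>x. coframe_volume f (b(0 := x))"
        by (rule is_form_linear[OF is_form_volume]) simp
      have "coframe_volume f b' = - coframe_volume f b"
        using v.neg[of "b 0"] by (simp add: b'_def)
      moreover have "coframe_volume f b \<noteq> 0" using volume_orthonormal[OF on] by auto
      ultimately have "coframe_volume f b' > 0" using False by simp
      moreover have "coframe_metric f (b' i) (b' j) = (if i = j then 1 else 0)" if "i < 8" "j < 8" for i j
        using on[OF that] g.neg metric_commute[of "- b 0" "b j"] metric_commute[of "b 0" "b j"] metric_commute[of "- b 0" "- b 0"]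
        by (auto simp: b'_def g.neg metric_commute[of "- b 0" "b 0"])
      ultimately have "\<alpha> (\<lambda>i. b' (k + i)) = 0"
        by (intro onb) (simp add: oriented_onb_def)
      moreover have "\<alpha> (\<lambda>i. b' (k + i)) = \<alpha> (\<lambda>i. B (K i))"
        using tail k by (intro is_form_cong[OF \<alpha>]) (simp add: b'_def)
      ultimately show ?thesis by simp
    qed
  qed
qed

text \<open>Existence is the complementary minor identity on each monomial; uniqueness is the
  vanishing criterion applied to the difference of two candidates.\<close>

lemma hodge_lincomb:
  assumes L: "\<forall>(c, I)\<in>set L. length I = k \<and> distinct I \<and> set I \<subseteq> {1..8}" and k: "1 \<le> k" "k \<le> 8"
  shows "hodge (coframe_metric f) (coframe_volume f) k (lincomb f L) = lincomb f (list_hodge L)"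
proof -
  have compl: "distinct (I @ complement I) \<and> sort (I @ complement I) = [1,2,3,4,5,6,7,8] \<and> length (complement I) = 8 - k"
    if "length I = k" "distinct I" "set I \<subseteq> {1..8}" for I
  proof -
    have d: "distinct (I @ complement I)" and s: "set (I @ complement I) = {1..8}"
      using that by (auto simp: distinct_complement set_complement)
    have sort: "sort (I @ complement I) = [1,2,3,4,5,6,7,8]"
      by (rule sorted_distinct_set_unique) (use d s indices8 in simp_all)
    have "length (I @ complement I) = 8" using arg_cong[OF sort, of length] by simp
    then show ?thesis using d sort that(1) by auto
  qed
  have form: "is_form (8 - k) (lincomb f (list_hodge L))"
  proof (intro is_form_lincomb ballI)
    fix x assume "x \<in> set (list_hodge L)"
    then obtain c I where I: "(c, I) \<in> set L" "x = (c * list_sign (I @ complement I), complement I)"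
      unfolding list_hodge_def by auto
    then have "length (complement I) = 8 - k" using L compl by blast
    moreover have "\<forall>i\<in>set (complement I). linear (f i)"
      unfolding set_complement using lin by blast
    ultimately show "case x of (c, I) \<Rightarrow> length I = 8 - k \<and> (\<forall>i\<in>set I. linear (f i))"
      using I by simp
  qed
  have eval: "lincomb f (list_hodge L) (\<lambda>i. b (k + i)) = lincomb f L b"
    if "oriented_onb (coframe_metric f) (coframe_volume f) b" for b
  proof -
    have on: "coframe_metric f (b i) (b j) = (if i = j then 1 else 0)" if "i < 8" "j < 8" for i j
      using \<open>oriented_onb _ _ b\<close> that by (simp add: oriented_onb_def)
    have "coframe_volume f b = 1"
    proof -
      have "(coframe_volume f b - 1) * (coframe_volume f b + 1) = 0"
        using volume_orthonormal[OF on] by (simp add: algebra_simps)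
      then show ?thesis using that by (auto simp: oriented_onb_def)
    qed
    then have mono: "list_sign (I @ complement I) * monomial f (complement I) (\<lambda>i. b (k + i)) = monomial f I b"
      if "length I = k" "distinct I" "set I \<subseteq> {1..8}" for I
      using monomial_complement[OF on, of I "complement I"] list_sign_square[of I "complement I"] compl[OF that] that
      by (simp flip: mult.assoc)
    show ?thesis using L
    proof (induction L)
      case (Cons x L)
      obtain c I where "x = (c, I)" by force
      with Cons mono[of I] show ?case
        by (simp add: lincomb_Cons list_hodge_def mult.assoc)
    qed (simp add: lincomb_Nil list_hodge_def)
  qed
  show ?thesis
    unfolding hodge_def
  proof (rule the_equality)
    show "is_form (8 - k) (lincomb f (list_hodge L)) \<and> (\<forall>b. oriented_onb (coframe_metric f) (coframe_volume f) b \<longrightarrow>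
        lincomb f (list_hodge L) (\<lambda>i. b (k + i)) = lincomb f L b)"
      using form eval by blast
  next
    fix \<gamma> assume \<gamma>: "is_form (8 - k) \<gamma> \<and> (\<forall>b. oriented_onb (coframe_metric f) (coframe_volume f) b \<longrightarrow>
        \<gamma> (\<lambda>i. b (k + i)) = lincomb f L b)"
    have "(\<lambda>v. \<gamma> v - lincomb f (list_hodge L) v) = (\<lambda>v. 0)"
      using \<gamma> form eval k by (intro form_eq_0_on_oriented_onb[of "8 - k" _ k] is_form_diff) auto
    then show "\<gamma> = lincomb f (list_hodge L)"
      by (simp add: fun_eq_iff)
  qed
qed

end

section \<open>The model form\<close>

text \<open>Indices occur as numerals in the rewrite rules below; turning 1 into
  \<open>Suc 0\<close> would keep these rules from matching.\<close>

declare One_nat_def [simp del]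

definition model_list :: "(real \<times> nat list) list" where
  "model_list = [(1, [1,2,3,4]), (1, [1,2,5,6]), (-1, [1,2,7,8]), (1, [1,3,5,7]), (1, [1,3,6,8]),
     (1, [1,4,5,8]), (-1, [1,4,6,7]), (1, [5,6,7,8]), (1, [3,4,7,8]), (-1, [3,4,5,6]),
     (1, [2,4,6,8]), (1, [2,4,5,7]), (-1, [2,3,5,8]), (1, [2,3,6,7])]"

lemma model_form_lincomb: "model_form f = lincomb f model_list"
  by (simp add: model_form_def lincomb_def model_list_def fun_eq_iff)

text \<open>The 14 monomials form seven pairs with complementary index sets, and each ordered pair
  contributes +1; every other product repeats an index.\<close>

lemma wedge_model_form:
  "wedge 4 4 (model_form f) (model_form f) = (\<lambda>v. 14 * coframe_volume f v)"
proof -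
  have "wedge 4 4 (model_form f) (model_form f) = lincomb f (list_normal (list_wedge model_list model_list))"
    unfolding model_form_lincomb lincomb_normal by (rule wedge_lincomb) (simp_all add: model_list_def)
  also have "\<dots> = (\<lambda>v. 14 * coframe_volume f v)"
    by (simp add: model_list_def list_wedge_def list_normal_def lincomb_def coframe_volume_def)
  finally show ?thesis .
qed

definition index_pairs :: "(nat \<times> nat) list" where
  "index_pairs = [(1,2),(1,3),(1,4),(1,5),(1,6),(1,7),(1,8),(2,3),(2,4),(2,5),(2,6),(2,7),(2,8),
     (3,4),(3,5),(3,6),(3,7),(3,8),(4,5),(4,6),(4,7),(4,8),(5,6),(5,7),(5,8),(6,7),(6,8),(7,8)]"

definition pair_list :: "(nat \<Rightarrow> nat \<Rightarrow> real) \<Rightarrow> (real \<times> nat list) list" where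
  "pair_list r = map (\<lambda>(i, j). (r i j, [i, j])) index_pairs"

text \<open>The inner product on 2-forms for which the monomials with increasing indices are
  orthonormal.\<close>

definition pairing :: "(nat \<Rightarrow> nat \<Rightarrow> real) \<Rightarrow> (nat \<Rightarrow> nat \<Rightarrow> real) \<Rightarrow> real" where
  "pairing r s = (\<Sum>(i, j)\<leftarrow>index_pairs. r i j * s i j)"

text \<open>The action \<open>\<omega> \<mapsto> \<star>(\<omega> \<and> \<Phi>)\<close> of the model form on the coefficients of a 2-form; its
  eigenvalues are \<open>-3\<close> and \<open>1\<close>.\<close>

definition model_action :: "(nat \<Rightarrow> nat \<Rightarrow> real) \<Rightarrow> nat \<Rightarrow> nat \<Rightarrow> real" where
  "model_action r i j = (\<Sum>(c, I)\<leftarrow>model_list. let J = [x \<leftarrow> I. x \<noteq> i \<and> x \<noteq> j] in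
     if length J = 2 then c * list_sign (i # j # J) * r (J ! 0) (J ! 1) else 0)"

text \<open>Each index pair lies in exactly three of the 14 monomials, hence three terms per
  row.\<close>

lemma model_action_table:
  "model_action r 1 2 = r 3 4 + r 5 6 - r 7 8"
  "model_action r 1 3 = - r 2 4 + r 5 7 + r 6 8"
  "model_action r 1 4 = r 2 3 + r 5 8 - r 6 7"
  "model_action r 1 5 = - r 2 6 - r 3 7 - r 4 8"
  "model_action r 1 6 = r 2 5 - r 3 8 + r 4 7"
  "model_action r 1 7 = r 2 8 + r 3 5 - r 4 6"
  "model_action r 1 8 = - r 2 7 + r 3 6 + r 4 5"
  "model_action r 2 3 = r 1 4 - r 5 8 + r 6 7"
  "model_action r 2 4 = - r 1 3 + r 6 8 + r 5 7"
  "model_action r 2 5 = r 1 6 - r 4 7 + r 3 8"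
  "model_action r 2 6 = - r 1 5 - r 4 8 - r 3 7"
  "model_action r 2 7 = - r 1 8 + r 4 5 + r 3 6"
  "model_action r 2 8 = r 1 7 + r 4 6 - r 3 5"
  "model_action r 3 4 = r 1 2 + r 7 8 - r 5 6"
  "model_action r 3 5 = r 1 7 + r 4 6 - r 2 8"
  "model_action r 3 6 = r 1 8 - r 4 5 + r 2 7"
  "model_action r 3 7 = - r 1 5 - r 4 8 - r 2 6"
  "model_action r 3 8 = - r 1 6 + r 4 7 + r 2 5"
  "model_action r 4 5 = r 1 8 - r 3 6 + r 2 7"
  "model_action r 4 6 = - r 1 7 + r 3 5 + r 2 8"
  "model_action r 4 7 = r 1 6 + r 3 8 - r 2 5"
  "model_action r 4 8 = - r 1 5 - r 3 7 - r 2 6"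
  "model_action r 5 6 = r 1 2 + r 7 8 - r 3 4"
  "model_action r 5 7 = r 1 3 - r 6 8 + r 2 4"
  "model_action r 5 8 = r 1 4 + r 6 7 - r 2 3"
  "model_action r 6 7 = - r 1 4 + r 5 8 + r 2 3"
  "model_action r 6 8 = r 1 3 - r 5 7 + r 2 4"
  "model_action r 7 8 = - r 1 2 + r 5 6 + r 3 4"
  by (simp_all add: model_action_def model_list_def)


lemma model_action_square:
  assumes "(i, j) \<in> set index_pairs"
  shows "model_action (model_action r) i j = - 2 * model_action r i j + 3 * r i j"
  using assms by (auto simp: index_pairs_def model_action_table)

text \<open>T is symmetric because the coefficients of a 4-form are unchanged when the two index
  pairs are exchanged.\<close>

lemma pairing_model_action_commute: "pairing (model_action r) s = pairing r (model_action s)"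
  by (simp add: pairing_def index_pairs_def model_action_table algebra_simps)

lemma pairing_cong:
  assumes "\<And>i j. (i, j) \<in> set index_pairs \<Longrightarrow> s i j = s' i j"
  shows "pairing r s = pairing r s'"
  unfolding pairing_def by (rule arg_cong[where f = sum_list], rule map_cong) (auto simp: assms)

lemma pairing_linear: "pairing r (\<lambda>i j. a * s i j + b * s' i j) = a * pairing r s + b * pairing r s'"
  by (simp add: pairing_def index_pairs_def algebra_simps)

lemma pairing_model_action_square:
  "pairing r (model_action (model_action s)) = - 2 * pairing r (model_action s) + 3 * pairing r s"
proof -
  have "pairing r (model_action (model_action s)) =
      pairing r (\<lambda>i j. (- 2) * model_action s i j + 3 * s i j)"
    by (rule pairing_cong) (simp add: model_action_square)
  then show ?thesis by (simp only: pairing_linear)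
qed

text \<open>\<open>model_action\<close> is defined by contraction with the model form; that it also
  gives \<star>(\<omega> \<and> \<Phi>) expresses the self-duality of the model form.\<close>

lemma wedge_pair_list_model_form:
  "wedge 2 4 (lincomb f (pair_list r)) (model_form f) = lincomb f (list_hodge (pair_list (model_action r)))"
proof -
  have "wedge 2 4 (lincomb f (pair_list r)) (model_form f) =
      lincomb f (list_normal (list_wedge (pair_list r) model_list))"
    unfolding model_form_lincomb lincomb_normal
    by (rule wedge_lincomb) (simp_all add: model_list_def pair_list_def index_pairs_def)
  also have "\<dots> = lincomb f (list_hodge (pair_list (model_action r)))"
    by (simp add: pair_list_def index_pairs_def model_list_def list_wedge_def list_normal_def
      list_hodge_def complement_def lincomb_def model_action_table fun_eq_iff algebra_simps)
  finally show ?thesis .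
qed

lemma wedge_pair_list_hodge:
  "wedge 2 6 (lincomb f (pair_list r)) (lincomb f (list_hodge (pair_list s))) =
    (\<lambda>v. pairing r s * coframe_volume f v)"
proof -
  have "wedge 2 6 (lincomb f (pair_list r)) (lincomb f (list_hodge (pair_list s))) =
      lincomb f (list_normal (list_wedge (pair_list r) (list_hodge (pair_list s))))"
    unfolding lincomb_normal
    by (rule wedge_lincomb) (simp_all add: pair_list_def index_pairs_def list_hodge_def complement_def)
  also have "\<dots> = (\<lambda>v. pairing r s * coframe_volume f v)"
    by (simp add: pair_list_def index_pairs_def list_wedge_def list_normal_def
      list_hodge_def complement_def lincomb_def coframe_volume_def pairing_def fun_eq_iff algebra_simps)
  finally show ?thesis .
qed

section \<open>Contraction of the model form with two vectors\<close>

lemma monomial_triple: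
  assumes "linear (f b)" "linear (f c)"
  shows "monomial f [a, b, c] v =
    f a (v 0) * (f b (v 1) * f c (v 2) - f b (v 2) * f c (v 1))
    - f a (v 1) * (f b (v 0) * f c (v 2) - f b (v 2) * f c (v 0))
    + f a (v 2) * (f b (v 0) * f c (v 1) - f b (v 1) * f c (v 0))"
  using assms
  by (subst monomial_Cons_eval) (auto simp: monomial_pair lessThan_Suc One_nat_def numeral_2_eq_2 algebra_simps)

lemma monomial_quadruple:
  assumes "linear (f b)" "linear (f c)" "linear (f d)"
  shows "monomial f [a, b, c, d] v =
    (f a (v 0) * f b (v 1) - f a (v 1) * f b (v 0)) * (f c (v 2) * f d (v 3) - f c (v 3) * f d (v 2))
    - (f a (v 0) * f b (v 2) - f a (v 2) * f b (v 0)) * (f c (v 1) * f d (v 3) - f c (v 3) * f d (v 1))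
    + (f a (v 0) * f b (v 3) - f a (v 3) * f b (v 0)) * (f c (v 1) * f d (v 2) - f c (v 2) * f d (v 1))
    + (f a (v 1) * f b (v 2) - f a (v 2) * f b (v 1)) * (f c (v 0) * f d (v 3) - f c (v 3) * f d (v 0))
    - (f a (v 1) * f b (v 3) - f a (v 3) * f b (v 1)) * (f c (v 0) * f d (v 2) - f c (v 2) * f d (v 0))
    + (f a (v 2) * f b (v 3) - f a (v 3) * f b (v 2)) * (f c (v 0) * f d (v 1) - f c (v 1) * f d (v 0))"
  using assms
  by (subst monomial_Cons_eval) (auto simp: monomial_triple lessThan_Suc One_nat_def eval_nat_numeral algebra_simps)

text \<open>Pluecker coordinates of the plane spanned by u and w; if f is orthonormal, these are the
  components of the 2-form obtained from u and w by lowering indices.\<close>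

definition minor :: "(nat \<Rightarrow> 'v \<Rightarrow> real) \<Rightarrow> 'v \<Rightarrow> 'v \<Rightarrow> nat \<Rightarrow> nat \<Rightarrow> real" where
  "minor f u w i j = f i u * f j w - f i w * f j u"

text \<open>The arguments are u, w, v 0, v 1; the 4 by 4 determinant is expanded along its first two
  columns.\<close>

lemma monomial_quadruple_contract:
  assumes "linear (f b)" "linear (f c)" "linear (f d)"
  shows "monomial f [a, b, c, d] (case_nat u (case_nat w v)) =
    minor f u w a b * monomial f [c, d] v - minor f u w a c * monomial f [b, d] v
    + minor f u w a d * monomial f [b, c] v + minor f u w b c * monomial f [a, d] v
    - minor f u w b d * monomial f [a, c] v + minor f u w c d * monomial f [a, b] v"
  using assms
  by (simp add: monomial_quadruple monomial_pair minor_def One_nat_def eval_nat_numeral algebra_simps)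

lemma model_form_contract:
  assumes lin: "\<And>i. i \<in> {1..8} \<Longrightarrow> linear (f i)"
  shows "(\<lambda>v. model_form f (case_nat u (case_nat w v))) = lincomb f (pair_list (model_action (minor f u w)))"
proof -
  have "linear (f 1)" "linear (f 2)" "linear (f 3)" "linear (f 4)" "linear (f 5)" "linear (f 6)"
    "linear (f 7)" "linear (f 8)"
    by (simp_all add: lin)
  then show ?thesis
    by (simp add: model_form_def monomial_quadruple_contract pair_list_def index_pairs_def
      lincomb_def model_action_table fun_eq_iff algebra_simps)
qed

text \<open>The pairing is the value of the model form on u, w, u, w.\<close>

lemma pairing_minor_model_action: "pairing (minor f u w) (model_action (minor f u w)) = 0"
  by (simp add: pairing_def index_pairs_def model_action_table minor_def algebra_simps)

lemma sum_indices8: "(\<Sum>i=1..8. h i) = h 1 + h 2 + h 3 + h 4 + h 5 + h 6 + h 7 + h (8 :: nat)"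
  for h :: "nat \<Rightarrow> 'b::comm_monoid_add"
  by (simp add: One_nat_def eval_nat_numeral atLeastAtMostSuc_conv add_ac)

text \<open>Lagrange's identity for a Gram determinant.\<close>

lemma pairing_minor:
  "pairing (minor f u w) (minor f u w) =
    coframe_metric f u u * coframe_metric f w w - coframe_metric f u w * coframe_metric f u w"
  unfolding coframe_metric_def sum_indices8
  by (simp add: pairing_def index_pairs_def minor_def algebra_simps)

text \<open>The left-hand side depends on the 4-form alone, and so do therefore the areas on the right.\<close>

lemma area_from_model_form:
  assumes lin: "\<And>i. i \<in> {1..8} \<Longrightarrow> linear (f i)"
  defines "\<omega> \<equiv> \<lambda>u w v. model_form f (case_nat u (case_nat w v))"
  shows "wedge 2 6 (\<omega> u w) (wedge 2 4 (\<omega> u w) (model_form f)) =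
    (\<lambda>v. - 6 * (coframe_metric f u u * coframe_metric f w w - coframe_metric f u w * coframe_metric f u w)
      * coframe_volume f v)"
proof -
  let ?p = "minor f u w"
  \<comment> \<open>Origin of the factor -6: as T is symmetric, <T p, T^2 p> = 3 <T p, p> - 2 <p,
    T^2 p>, and since <p, T p> = 0 this is -2 times 3 <p, p>.\<close>
  have "pairing (model_action ?p) (model_action (model_action ?p)) = - 6 * pairing ?p ?p"
    by (simp add: pairing_model_action_square pairing_model_action_commute pairing_minor_model_action)
  moreover have "\<omega> u w = lincomb f (pair_list (model_action ?p))"
    unfolding \<omega>_def by (rule model_form_contract[OF lin])
  ultimately show ?thesis
    by (simp add: wedge_pair_list_model_form wedge_pair_list_hodge pairing_minor)
qed

section \<open>The metric and the volume form of an admissible form\<close>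

text \<open>\<open>is_coframe\<close> speaks of 1-forms only; the vectors dual to f' are built from
  the known frame B with the transposed transition coefficients.\<close>

lemma dual_frame_of_coframe:
  fixes f f' :: "nat \<Rightarrow> 'v::real_vector \<Rightarrow> real"
  assumes "dual_frame f B" and f': "is_coframe f'"
  shows "\<exists>B'. dual_frame f' B'"
proof -
  interpret dual_frame f B by fact
  have lin': "\<And>i. i \<in> {1..8} \<Longrightarrow> linear (f' i)"
    and ind': "\<And>c i. (\<And>x. (\<Sum>i=1..8. c i * f' i x) = 0) \<Longrightarrow> i \<in> {1..8} \<Longrightarrow> c i = 0"
    and span': "\<And>\<alpha>. linear \<alpha> \<Longrightarrow> \<exists>c. \<forall>x. \<alpha> x = (\<Sum>i=1..8. c i * f' i x)"
    using f' unfolding is_coframe_def by blast+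
  have "\<forall>j. \<exists>c. j \<in> {1..8} \<longrightarrow> (\<forall>x. f j x = (\<Sum>i=1..8. c i * f' i x))"
    using span' lin by blast
  then obtain C where C: "\<And>j x. j \<in> {1..8} \<Longrightarrow> f j x = (\<Sum>i=1..8. C j i * f' i x)"
    by metis
  define B' where "B' i = (\<Sum>j=1..8. C j i *\<^sub>R B j)" for i
  have fB': "f' k (B' i) = (\<Sum>j=1..8. C j i * f' k (B j))" if "k \<in> {1..8}" for k i
    unfolding B'_def using lin'[OF that] by (simp add: linear_sum linear_scale)
  have expand': "x = (\<Sum>i=1..8. f' i x *\<^sub>R B' i)" for x
  proof -
    have "(\<Sum>i=1..8. f' i x *\<^sub>R B' i) = (\<Sum>i=1..8. \<Sum>j=1..8. (C j i * f' i x) *\<^sub>R B j)"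
      by (simp add: B'_def scaleR_sum_right mult.commute)
    also have "\<dots> = (\<Sum>j=1..8. (\<Sum>i=1..8. C j i * f' i x) *\<^sub>R B j)"
      by (subst sum.swap) (simp add: scaleR_sum_left)
    also have "\<dots> = (\<Sum>j=1..8. f j x *\<^sub>R B j)"
      by (intro sum.cong refl) (simp add: C)
    finally show ?thesis using expand[of x] by simp
  qed
  have dual': "f' k (B' i) = (if k = i then 1 else 0)" if k: "k \<in> {1..8}" and i: "i \<in> {1..8}" for k i
  proof -
    \<comment> \<open>Expanding f' k in the candidate frame yields a linear relation among the
      1-forms of f', and their independence forces duality.\<close>
    have "(\<Sum>i=1..8. (f' k (B' i) - (if k = i then 1 else 0)) * f' i x) = 0" for x
    proof -
      have "f' k x = (\<Sum>i=1..8. f' i x * f' k (B' i))"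
        using arg_cong[OF expand'[of x], of "f' k"] lin'[OF k] by (simp add: linear_sum linear_scale)
      moreover have "(\<Sum>i=1..8. (if k = i then 1 else 0) * f' i x) = (\<Sum>i=1..8. if k = i then f' i x else 0)"
        by (intro sum.cong) auto
      ultimately show ?thesis
        using k by (simp add: left_diff_distrib right_diff_distrib sum_subtractf mult.commute)
    qed
    then have "f' k (B' i) - (if k = i then 1 else 0) = 0"
      by (rule ind'[of "\<lambda>i. f' k (B' i) - (if k = i then 1 else 0)", OF _ i])
    then show ?thesis by simp
  qed
  show ?thesis
    by (rule exI[of _ B'], rule dual_frame.intro) (fact lin', fact dual', fact expand')
qed

context dual_frame
begin

lemma coframe: "is_coframe f"
  unfolding is_coframe_def
proof (intro conjI allI impI ballI)
  show "linear (f i)" if "i \<in> {1..8}" for i by (rule lin[OF that])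
next
  fix c :: "nat \<Rightarrow> real" and i :: nat
  assume c: "\<forall>x. (\<Sum>i=1..8. c i * f i x) = 0" and i: "i \<in> {1..8}"
  have "(\<Sum>j=1..8. c j * f j (B i)) = (\<Sum>j=1..8. if j = i then c j else 0)"
    by (intro sum.cong refl) (use i dual in simp)
  also have "\<dots> = c i" using i by simp
  finally show "c i = 0" using c by simp
next
  fix \<alpha> :: "'v \<Rightarrow> real" assume \<alpha>: "linear \<alpha>"
  show "\<exists>c. \<forall>x. \<alpha> x = (\<Sum>i=1..8. c i * f i x)"
  proof (intro exI allI)
    fix x
    have "\<alpha> (\<Sum>i=1..8. f i x *\<^sub>R B i) = (\<Sum>i=1..8. \<alpha> (B i) * f i x)"
      using \<alpha> by (simp add: linear_sum linear_scale mult.commute)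
    then show "\<alpha> x = (\<Sum>i=1..8. \<alpha> (B i) * f i x)"
      by (simp flip: expand)
  qed
qed

lemma volume_frame: "coframe_volume f (\<lambda>i. B ([1,2,3,4,5,6,7,8] ! i)) = 1"
  unfolding coframe_volume_def using lin dual by (intro monomial_frame) auto

text \<open>If the Gram matrix \<open>G\<close> of \<open>g\<close> in the frame had a nonzero entry \<open>G i j\<close> off the diagonal, then the
  polarised identity \<open>G i j * G k k = G i k * G j k\<close> would make the area of \<open>B j\<close>, \<open>B k\<close> vanish.\<close>

lemma metric_eq_of_areas:
  assumes g: "inner_product g"
    and area: "\<And>u w. g u u * g w w - g u w * g u w =
      coframe_metric f u u * coframe_metric f w w - coframe_metric f u w * coframe_metric f u w"
  shows "g = coframe_metric f"
proof -
  define G where "G i j = g (B i) (B j)" for i j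
  have gl: "linear (g x)" and gc: "g x y = g y x" for x y
    using g by (auto simp: inner_product_def)
  have ml: "coframe_metric f (x + y) z = coframe_metric f x z + coframe_metric f y z"
    "coframe_metric f z (x + y) = coframe_metric f z x + coframe_metric f z y" for x y z
    by (simp_all add: linear_add[OF linear_metric] metric_commute[of _ z])
  have gadd: "g (x + y) z = g x z + g y z" "g z (x + y) = g z x + g z y" for x y z
    by (simp_all add: linear_add[OF gl] gc[of _ z])
  have m: "coframe_metric f (B i) (B j) = (if i = j then 1 else 0)" if "i \<in> {1..8}" "j \<in> {1..8}" for i j
    using that dual by (simp add: metric_frame)
  have G1: "G i i * G j j - G i j * G i j = 1" if "i \<in> {1..8}" "j \<in> {1..8}" "i \<noteq> j" for i j
    using area[of "B i" "B j"] that by (simp add: G_def m)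
  have G2: "G i j * G k k = G i k * G j k"
    if ijk: "i \<in> {1..8}" "j \<in> {1..8}" "k \<in> {1..8}" "i \<noteq> j" "i \<noteq> k" "j \<noteq> k" for i j k
  proof -
    \<comment> \<open>The vectors B i + B j and B k span a parallelogram of squared area 2;
      subtracting two instances of \<open>G1\<close> leaves the mixed term.\<close>
    have "(G i i + 2 * G i j + G j j) * G k k - (G i k + G j k) * (G i k + G j k) = 2"
      using area[of "B i + B j" "B k"] ijk
      by (simp add: ml gadd m G_def gc[of "B j" "B i"] algebra_simps)
    then show ?thesis
      using G1[of i k] G1[of j k] ijk by (simp add: algebra_simps)
  qed
  have third: "\<exists>k\<in>{1..8}. k \<noteq> i \<and> k \<noteq> j" for i j :: nat
  proof -
    have "1 \<noteq> i \<and> 1 \<noteq> j \<or> 2 \<noteq> i \<and> 2 \<noteq> j \<or> 3 \<noteq> i \<and> 3 \<noteq> j" by presburger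
    then show ?thesis by force
  qed
  have off: "G i j = 0" if ij: "i \<in> {1..8}" "j \<in> {1..8}" "i \<noteq> j" for i j
  proof (rule ccontr)
    assume nz: "G i j \<noteq> 0"
    obtain k where k: "k \<in> {1..8}" "k \<noteq> i" "k \<noteq> j" using third by blast
    have "G i j * G k k = G i k * G j k" "G i k * G j j = G i j * G j k"
      using G2[of i j k] G2[of i k j] ij k gc by (auto simp: G_def)
    then have "G i j * (G j j * G k k - G j k * G j k) = 0"
      by algebra
    then show False using nz G1[of j k] ij k by simp
  qed
  have diag: "G i i = 1" if i: "i \<in> {1..8}" for i
  proof -
    obtain j where j: "j \<in> {1..8}" "j \<noteq> i" using third by blast
    obtain k where k: "k \<in> {1..8}" "k \<noteq> i" "k \<noteq> j" using third by blast
    \<comment> \<open>Two directions alone would admit diag(s, 1/s), which has the same area; the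
      third one forces every square to be 1.\<close>
    have p: "G i i * G j j = 1" "G i i * G k k = 1" "G j j * G k k = 1"
      using G1[of i j] G1[of i k] G1[of j k] off i j k by auto
    then have "G i i * G i i = 1" by algebra
    moreover have "G i i > 0"
    proof -
      have "B i \<noteq> 0" using dual[OF i i] linear_0[OF lin[OF i]] by auto
      then show ?thesis using g by (simp add: G_def inner_product_def)
    qed
    moreover have "(G i i - 1) * (G i i + 1) = G i i * G i i - 1" by (simp add: algebra_simps)
    ultimately have "(G i i - 1) * (G i i + 1) = 0" "G i i > 0" by simp_all
    then show ?thesis by auto
  qed
  have Bg: "g (B i) y = f i y" if i: "i \<in> {1..8}" for i y
  proof -
    have "g (B i) (\<Sum>j=1..8. f j y *\<^sub>R B j) = (\<Sum>j=1..8. f j y * G i j)"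
      by (simp add: linear_sum[OF gl] linear_scale[OF gl] G_def)
    also have "\<dots> = (\<Sum>j=1..8. if i = j then f j y else 0)"
      using off diag i by (intro sum.cong refl) auto
    also have "\<dots> = f i y" using i by simp
    finally show ?thesis by (simp flip: expand)
  qed
  have "g x y = coframe_metric f x y" for x y
  proof -
    have "g y (\<Sum>i=1..8. f i x *\<^sub>R B i) = (\<Sum>i=1..8. f i x * g y (B i))"
      by (simp add: linear_sum[OF gl] linear_scale[OF gl])
    also have "\<dots> = coframe_metric f x y"
      unfolding coframe_metric_def by (intro sum.cong refl) (simp add: gc[of y] Bg)
    finally show ?thesis by (simp add: gc[of x y] flip: expand)
  qed
  then show ?thesis by (intro ext)
qed

text \<open>The volume form is settled before the metric: the area identity carries it as a factor,
  which can be cancelled only once both sides share it.\<close>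

lemma adapted_coframe_unique:
  assumes "adapted_coframe \<Phi> f" "adapted_coframe \<Phi> f'"
  shows "coframe_volume f' = coframe_volume f" "coframe_metric f' = coframe_metric f"
proof -
  have model: "model_form f' = model_form f" and cof: "is_coframe f'"
    using assms by (auto simp: adapted_coframe_def)
  obtain B' where "dual_frame f' B'"
    using dual_frame_of_coframe[OF dual_frame_axioms cof] by blast
  then interpret f': dual_frame f' B' .
  have "(\<lambda>v. 14 * coframe_volume f' v) = (\<lambda>v. 14 * coframe_volume f v)"
    unfolding wedge_model_form[symmetric] model ..
  then show vol: "coframe_volume f' = coframe_volume f"
    by (simp add: fun_eq_iff)
  have "coframe_metric f' u u * coframe_metric f' w w - coframe_metric f' u w * coframe_metric f' u w =
      coframe_metric f u u * coframe_metric f w w - coframe_metric f u w * coframe_metric f u w" for u w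
  proof -
    have "(\<lambda>v. - 6 * (coframe_metric f' u u * coframe_metric f' w w - coframe_metric f' u w * coframe_metric f' u w)
        * coframe_volume f v) =
      (\<lambda>v. - 6 * (coframe_metric f u u * coframe_metric f w w - coframe_metric f u w * coframe_metric f u w)
        * coframe_volume f v)"
      using area_from_model_form[of f' u w, OF f'.lin] area_from_model_form[of f u w, OF lin]
      unfolding model vol by simp
    from fun_cong[OF this, of "\<lambda>i. B ([1,2,3,4,5,6,7,8] ! i)"] show ?thesis
      by (simp add: volume_frame)
  qed
  then show "coframe_metric f' = coframe_metric f"
    by (rule metric_eq_of_areas[OF f'.inner_product_metric])
qed

lemma induced_metric_eq:
  assumes "adapted_coframe \<Phi> f" shows "induced_metric \<Phi> = coframe_metric f"
  unfolding induced_metric_def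
proof (rule the_equality)
  show "\<forall>f'. adapted_coframe \<Phi> f' \<longrightarrow> coframe_metric f = (\<lambda>x y. \<Sum>i=1..8. f' i x * f' i y)"
    using adapted_coframe_unique(2)[OF assms] unfolding coframe_metric_def by metis
  show "g = coframe_metric f"
    if "\<forall>f'. adapted_coframe \<Phi> f' \<longrightarrow> g = (\<lambda>x y. \<Sum>i=1..8. f' i x * f' i y)" for g
    using that assms unfolding coframe_metric_def by blast
qed

lemma induced_volume_eq:
  assumes "adapted_coframe \<Phi> f" shows "induced_volume \<Phi> = coframe_volume f"
  unfolding induced_volume_def
proof (rule the_equality)
  show "\<forall>f'. adapted_coframe \<Phi> f' \<longrightarrow> coframe_volume f = monomial f' [1,2,3,4,5,6,7,8]"
    using adapted_coframe_unique(1)[OF assms] unfolding coframe_volume_def by metis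
  show "\<nu> = coframe_volume f"
    if "\<forall>f'. adapted_coframe \<Phi> f' \<longrightarrow> \<nu> = monomial f' [1,2,3,4,5,6,7,8]" for \<nu>
    using that assms unfolding coframe_volume_def by blast
qed

lemma star_lincomb:
  assumes "adapted_coframe \<Phi> f" "\<forall>(c, I)\<in>set L. length I = k \<and> distinct I \<and> set I \<subseteq> {1..8}" "1 \<le> k" "k \<le> 8"
  shows "star \<Phi> k (lincomb f L) = lincomb f (list_hodge L)"
  unfolding star_def induced_metric_eq[OF assms(1)] induced_volume_eq[OF assms(1)]
  by (rule hodge_lincomb[OF assms(2-4)])

end

section \<open>Coordinates on the tangent space\<close>

lemma to_lie_mem: "to_lie x \<in> span (basis_vec ` {1..8})"
  by (rule to_lie)

lemma to_lie_add: "to_lie (x + y) = to_lie x + to_lie y"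
  unfolding plus_tangent_def by (rule of_lie_inverse) (intro span_add to_lie_mem)

lemma to_lie_scaleR: "to_lie (c *\<^sub>R x) = c *\<^sub>R to_lie x"
  unfolding scaleR_tangent_def by (rule of_lie_inverse) (intro span_scale to_lie_mem)

lemma linear_to_lie: "linear to_lie"
  by (intro linearI to_lie_add to_lie_scaleR)

lemma to_lie_frame: "i \<in> {1..8} \<Longrightarrow> to_lie (frame i) = basis_vec i"
  unfolding frame_def by (rule of_lie_inverse) (auto intro: span_base)

text \<open>The entries are those of the first column of the first factor, where elements of
  \<open>lie_h\<close> vanish, and of the second factor. The functionals are thus defined on all
  matrix pairs, vanish on \<open>lie_h\<close>, and the constants make them dual to
  \<open>basis_vec\<close>, for instance sqrt 3 / 2 against the entry 2 / sqrt 3.\<close>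

definition coord :: "nat \<Rightarrow> matrix_pair \<Rightarrow> real" where
  "coord i X = [Re (fst X $ 2 $ 1), Im (fst X $ 2 $ 1), - Re (fst X $ 3 $ 1), Im (fst X $ 3 $ 1),
     sqrt 3 / 2 * Im (fst X $ 1 $ 1), - 2 * Im (snd X $ 2 $ 1), 2 * Re (snd X $ 2 $ 1),
     - 2 * Im (snd X $ 1 $ 1)] ! (i - 1)"

lemma coord_simps:
  "coord 1 X = Re (fst X $ 2 $ 1)" "coord 2 X = Im (fst X $ 2 $ 1)"
  "coord 3 X = - Re (fst X $ 3 $ 1)" "coord 4 X = Im (fst X $ 3 $ 1)"
  "coord 5 X = sqrt 3 / 2 * Im (fst X $ 1 $ 1)" "coord 6 X = - 2 * Im (snd X $ 2 $ 1)"
  "coord 7 X = 2 * Re (snd X $ 2 $ 1)" "coord 8 X = - 2 * Im (snd X $ 1 $ 1)"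
  by (simp_all add: coord_def)

lemma basis_vec_simps:
  "basis_vec 1 = (entry 1 2 (-1) + entry 2 1 1, 0)"
  "basis_vec 2 = (entry 1 2 \<i> + entry 2 1 \<i>, 0)"
  "basis_vec 3 = (entry 1 3 1 + entry 3 1 (-1), 0)"
  "basis_vec 4 = (entry 1 3 \<i> + entry 3 1 \<i>, 0)"
  "basis_vec 5 = ((1 / sqrt 3) *\<^sub>R (entry 1 1 (2 * \<i>) + entry 2 2 (- \<i>) + entry 3 3 (- \<i>)), 0)"
  "basis_vec 6 = (0, (- 1 / 2) *\<^sub>R (entry 1 2 \<i> + entry 2 1 \<i>))"
  "basis_vec 7 = (0, (1 / 2) *\<^sub>R (entry 1 2 (-1) + entry 2 1 1))"
  "basis_vec 8 = (0, (1 / 2) *\<^sub>R (entry 1 1 (- \<i>) + entry 2 2 \<i>))"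
  by (simp_all add: basis_vec_def)

lemma indices8_cases:
  assumes "i \<in> {1..8 :: nat}"
  obtains "i = 1" | "i = 2" | "i = 3" | "i = 4" | "i = 5" | "i = 6" | "i = 7" | "i = 8"
  using assms unfolding indices8 by auto

lemma linear_coord: "i \<in> {1..8} \<Longrightarrow> linear (coord i)"
  by (rule linearI; erule indices8_cases) (simp_all add: coord_simps algebra_simps)

lemma coord_basis_vec:
  assumes "i \<in> {1..8}" "j \<in> {1..8}"
  shows "coord i (basis_vec j) = (if i = j then 1 else 0)"
  using assms(2) by (rule indices8_cases; use assms(1) in \<open>rule indices8_cases\<close>)
    (simp_all add: coord_simps basis_vec_simps entry_def)

lemma linear_coord_sum: "linear (\<lambda>x. \<Sum>i=1..8. coord i x *\<^sub>R b i)"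
  by (rule linearI) (simp_all add: linear_add[OF linear_coord] linear_scale[OF linear_coord]
    scaleR_add_left sum.distrib scaleR_sum_right)

lemma to_lie_expand: "to_lie x = (\<Sum>i=1..8. coord i (to_lie x) *\<^sub>R basis_vec i)"
proof (rule linear_eq_on_span[OF linear_ident linear_coord_sum _ to_lie_mem])
  fix y assume "y \<in> basis_vec ` {1..8}"
  then obtain j where j: "j \<in> {1..8}" "y = basis_vec j" by auto
  have "(\<Sum>i=1..8. coord i y *\<^sub>R basis_vec i) = (\<Sum>i=1..8. if i = j then basis_vec i else 0)"
    using j by (intro sum.cong) (auto simp: coord_basis_vec)
  then show "y = (\<Sum>i=1..8. coord i y *\<^sub>R basis_vec i)" using j by simp
qed

lemma coord_expand: "x = (\<Sum>i=1..8. coord i (to_lie x) *\<^sub>R frame i)"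
proof -
  have "to_lie (\<Sum>i=1..8. coord i (to_lie x) *\<^sub>R frame i) = (\<Sum>i=1..8. coord i (to_lie x) *\<^sub>R basis_vec i)"
    by (simp add: linear_sum[OF linear_to_lie] to_lie_scaleR to_lie_frame)
  then show ?thesis using to_lie_expand[of x] by (simp add: to_lie_inject[symmetric])
qed

lemma linear_coord_to_lie: "i \<in> {1..8} \<Longrightarrow> linear (\<lambda>x. coord i (to_lie x))"
  using linear_compose[OF linear_to_lie linear_coord] by (simp add: o_def)

lemma coord_frame:
  "i \<in> {1..8} \<Longrightarrow> j \<in> {1..8} \<Longrightarrow> coord i (to_lie (frame j)) = (if i = j then 1 else 0)"
  by (simp add: to_lie_frame coord_basis_vec)

lemma inj_frame: "inj_on frame {1..8}"
proof (rule inj_onI)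
  fix i j assume "i \<in> {1..8}" "j \<in> {1..8}" "frame i = frame j"
  then show "i = j" using coord_frame[of i j] coord_frame[of i i] by (simp split: if_splits)
qed

lemma independent_frame: "independent (frame ` {1..8})"
proof (rule independent_if_scalars_zero)
  fix u y assume u: "(\<Sum>z\<in>frame ` {1..8}. u z *\<^sub>R z) = 0" and "y \<in> frame ` {1..8}"
  then obtain j where j: "j \<in> {1..8}" "y = frame j" by auto
  have "(\<Sum>i=1..8. u (frame i) *\<^sub>R frame i) = 0" using u by (simp add: sum.reindex[OF inj_frame])
  then have "coord j (to_lie (\<Sum>i=1..8. u (frame i) *\<^sub>R frame i)) = coord j (to_lie 0)" by simp
  then have "(\<Sum>i=1..8. u (frame i) * coord j (to_lie (frame i))) = 0"
    by (simp add: linear_sum[OF linear_coord_to_lie[OF j(1)]] linear_scale[OF linear_coord_to_lie[OF j(1)]]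
      linear_0[OF linear_coord_to_lie[OF j(1)]])
  moreover have "(\<Sum>i=1..8. u (frame i) * coord j (to_lie (frame i))) = (\<Sum>i=1..8. if i = j then u (frame i) else 0)"
    using j(1) by (intro sum.cong refl) (simp add: coord_frame)
  ultimately show "u y = 0" using j by simp
qed simp

text \<open>Trades \<open>representation\<close> for matrix entries, which rewriting can
  compute.\<close>

lemma coframe_eq_coord:
  assumes j: "j \<in> {1..8}" shows "coframe j x = coord j (to_lie x)"
proof -
  let ?B = "frame ` {1..8}"
  have sp: "frame i \<in> span ?B" if "i \<in> {1..8}" for i
    using that by (intro span_base imageI)
  have "representation ?B (\<Sum>i=1..8. coord i (to_lie x) *\<^sub>R frame i) (frame j) =
      (\<Sum>i=1..8. coord i (to_lie x) * representation ?B (frame i) (frame j))"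
  proof (subst representation_sum[OF independent_frame])
    show "coord i (to_lie x) *\<^sub>R frame i \<in> span ?B" if "i \<in> {1..8}" for i
      using that by (intro span_scale sp)
    show "(\<Sum>i=1..8. representation ?B (coord i (to_lie x) *\<^sub>R frame i) (frame j)) =
        (\<Sum>i=1..8. coord i (to_lie x) * representation ?B (frame i) (frame j))"
      by (intro sum.cong refl) (simp add: representation_scale[OF independent_frame sp])
  qed
  also have "\<dots> = (\<Sum>i=1..8. if i = j then coord i (to_lie x) else 0)"
  proof (intro sum.cong refl)
    fix i assume i: "i \<in> {1..8 :: nat}"
    have "representation ?B (frame i) (frame j) = (if frame j = frame i then 1 else 0)"
      using i by (subst representation_basis[OF independent_frame]) auto
    then show "coord i (to_lie x) * representation ?B (frame i) (frame j) = (if i = j then coord i (to_lie x) else 0)"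
      using inj_onD[OF inj_frame _ j i] by auto
  qed
  also have "\<dots> = coord j (to_lie x)" using j by simp
  finally show ?thesis unfolding coframe_def by (simp flip: coord_expand)
qed

interpretation tangent: dual_frame coframe frame
proof
  show "coframe i (frame j) = (if i = j then 1 else 0)" if "i \<in> {1..8}" "j \<in> {1..8}" for i j
    using that by (simp add: coframe_eq_coord coord_frame)
  show "x = (\<Sum>i=1..8. coframe i x *\<^sub>R frame i)" for x
    using coord_expand[of x] by (simp add: coframe_eq_coord)
  show "coframe i (x + y) = coframe i x + coframe i y" if "i \<in> {1..8}" for i x y
    using that by (simp add: coframe_eq_coord linear_add[OF linear_coord_to_lie])
  show "coframe i (c *\<^sub>R x) = c *\<^sub>R coframe i x" if "i \<in> {1..8}" for i c x
    using that by (simp add: coframe_eq_coord linear_scale[OF linear_coord_to_lie])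
qed

section \<open>Projection onto the tangent space\<close>

lemma adj_mult: "adj (A ** B) = adj B ** adj A"
  by (simp add: adj_def matrix_matrix_mult_def vec_eq_iff mult.commute)

lemma adj_adj: "adj (adj A) = A"
  by (simp add: adj_def vec_eq_iff)

lemma adj_diff: "adj (A - B) = adj A - adj B"
  and adj_add: "adj (A + B) = adj A + adj B"
  and adj_scaleR: "adj (c *\<^sub>R A) = c *\<^sub>R adj A"
  by (simp_all add: adj_def vec_eq_iff)

lemma trace_scaleR: "trace (c *\<^sub>R A) = c *\<^sub>R trace (A :: complex^'n^'n)"
  by (simp add: trace_def scaleR_sum_right)

lemma su_zero: "0 \<in> su"
  by (simp add: su_def adj_def trace_def vec_eq_iff)

lemma su_diff: "X \<in> su \<Longrightarrow> Y \<in> su \<Longrightarrow> X - Y \<in> su"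
  by (simp add: su_def adj_diff trace_sub)

lemma subspace_su: "subspace su"
  by (rule subspaceI) (auto simp: su_zero, auto simp: su_def adj_add adj_scaleR trace_add trace_scaleR)

lemma su_commutator:
  assumes "X \<in> su" "Y \<in> su" shows "X ** Y - Y ** X \<in> su"
proof -
  have "adj (X ** Y - Y ** X) = Y ** X - X ** Y"
    using assms by (simp add: su_def adj_diff adj_mult)
      (simp add: matrix_matrix_mult_def vec_eq_iff)
  then show ?thesis
    using trace_mul_sym[of X Y] by (simp add: su_def trace_sub)
qed

lemma to_lie_su: "fst (to_lie x) \<in> su" "snd (to_lie x) \<in> su"
proof -
  have "basis_vec i \<in> su \<times> su" if "i \<in> {1..8}" for i
    using that
    by (rule indices8_cases)
      (simp_all add: basis_vec_simps su_def adj_def trace_def entry_def vec_eq_iff forall_3 forall_2 sum_3 sum_2)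
  then have "span (basis_vec ` {1..8}) \<subseteq> su \<times> su"
    by (intro span_minimal subspace_Times subspace_su image_subsetI)
  then show "fst (to_lie x) \<in> su" "snd (to_lie x) \<in> su"
    using to_lie_mem[of x] by auto
qed

lemma coord_lie_h: "Z \<in> lie_h \<Longrightarrow> i \<in> {1..8} \<Longrightarrow> coord i Z = 0"
  by (erule indices8_cases)
    (auto simp: lie_h_def coord_simps vec_eq_iff matrix_vector_mult_def sum_3 forall_3)

text \<open>The functionals see only imaginary parts on the diagonal: skewness removes the real
  parts, and trace zero removes the last diagonal entry of the second factor.\<close>

lemma lie_hI:
  assumes Z: "fst Z \<in> su" "snd Z \<in> su" and coord: "\<And>i. i \<in> {1..8} \<Longrightarrow> coord i Z = 0"
  shows "Z \<in> lie_h"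
proof -
  obtain X Y where XY: "Z = (X, Y)" by force
  have c: "coord 1 Z = 0" "coord 2 Z = 0" "coord 3 Z = 0" "coord 4 Z = 0" "coord 5 Z = 0"
    "coord 6 Z = 0" "coord 7 Z = 0" "coord 8 Z = 0"
    by (simp_all add: coord)
  have X: "cnj (X $ j $ i) = - (X $ i $ j)" for i j
    using Z(1) by (simp add: XY su_def adj_def vec_eq_iff)
  have Y: "cnj (Y $ j $ i) = - (Y $ i $ j)" for i j
    using Z(2) by (simp add: XY su_def adj_def vec_eq_iff)
  have tr: "Y $ 1 $ 1 + Y $ 2 $ 2 = 0"
    using Z(2) by (simp add: XY su_def trace_def sum_2)
  have "X *v vector [1, 0, 0] = 0"
    using c X[of 1 1] by (auto simp: XY coord_simps vec_eq_iff matrix_vector_mult_def sum_3 forall_3 complex_eq_iff)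
  moreover have "Y = 0"
    using c Y[of 1 1] Y[of 1 2] Y[of 2 1] tr
    by (auto simp: XY coord_simps vec_eq_iff forall_2 complex_eq_iff)
  ultimately show ?thesis using Z by (simp add: lie_h_def XY)
qed

text \<open>As \<open>coord\<close> vanishes on \<open>lie_h\<close>, the coordinates of the
  projection are read off X without determining its component in \<open>lie_h\<close>.\<close>

lemma coframe_proj_m:
  assumes X: "fst X \<in> su" "snd X \<in> su" and i: "i \<in> {1..8}"
  shows "coframe i (proj_m X) = coord i X"
proof -
  define y where "y = (\<Sum>i=1..8. coord i X *\<^sub>R frame i)"
  have y: "coframe i y = coord i X" if "i \<in> {1..8}" for i
  proof -
    have "coframe i y = (\<Sum>j=1..8. coord j X * coframe i (frame j))"
      unfolding y_def using tangent.lin[OF that] by (simp add: linear_sum linear_scale)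
    also have "\<dots> = (\<Sum>j=1..8. if j = i then coord j X else 0)"
      using that by (intro sum.cong refl) (simp add: tangent.dual)
    finally show ?thesis using that by simp
  qed
  have "X - to_lie y \<in> lie_h"
  proof (rule lie_hI)
    show "fst (X - to_lie y) \<in> su" "snd (X - to_lie y) \<in> su"
      using X to_lie_su[of y] by (simp_all add: su_diff)
    show "coord i (X - to_lie y) = 0" if "i \<in> {1..8}" for i
      using y[OF that] that by (simp add: linear_diff[OF linear_coord] coframe_eq_coord)
  qed
  moreover have "z = y" if "X - to_lie z \<in> lie_h" for z
  proof (rule tangent.frame_eqI)
    fix i assume i: "i \<in> {1..8 :: nat}"
    show "coframe i z = coframe i y"
      using coord_lie_h[OF that i] y[OF i] i by (simp add: linear_diff[OF linear_coord] coframe_eq_coord)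
  qed
  ultimately have "proj_m X = y"
    unfolding proj_m_def by (rule the_equality)
  then show ?thesis using y[OF i] by simp
qed

lemma to_lie_entries:
  "fst (to_lie x) $ 1 $ 1 = Complex 0 (2 * coframe 5 x / sqrt 3)"
  "fst (to_lie x) $ 1 $ 2 = Complex (- coframe 1 x) (coframe 2 x)"
  "fst (to_lie x) $ 1 $ 3 = Complex (coframe 3 x) (coframe 4 x)"
  "fst (to_lie x) $ 2 $ 1 = Complex (coframe 1 x) (coframe 2 x)"
  "fst (to_lie x) $ 2 $ 2 = Complex 0 (- coframe 5 x / sqrt 3)"
  "fst (to_lie x) $ 2 $ 3 = 0"
  "fst (to_lie x) $ 3 $ 1 = Complex (- coframe 3 x) (coframe 4 x)"
  "fst (to_lie x) $ 3 $ 2 = 0"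
  "fst (to_lie x) $ 3 $ 3 = Complex 0 (- coframe 5 x / sqrt 3)"
  "snd (to_lie x) $ 1 $ 1 = Complex 0 (- coframe 8 x / 2)"
  "snd (to_lie x) $ 1 $ 2 = Complex (- coframe 7 x / 2) (- coframe 6 x / 2)"
  "snd (to_lie x) $ 2 $ 1 = Complex (coframe 7 x / 2) (- coframe 6 x / 2)"
  "snd (to_lie x) $ 2 $ 2 = Complex 0 (coframe 8 x / 2)"
proof -
  have "to_lie x = (\<Sum>i=1..8. coframe i x *\<^sub>R basis_vec i)"
    using to_lie_expand[of x] by (simp add: coframe_eq_coord)
  then have x: "to_lie x = coframe 1 x *\<^sub>R basis_vec 1 + coframe 2 x *\<^sub>R basis_vec 2
      + coframe 3 x *\<^sub>R basis_vec 3 + coframe 4 x *\<^sub>R basis_vec 4 + coframe 5 x *\<^sub>R basis_vec 5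
      + coframe 6 x *\<^sub>R basis_vec 6 + coframe 7 x *\<^sub>R basis_vec 7 + coframe 8 x *\<^sub>R basis_vec 8"
    unfolding sum_indices8 .
  note [simp] = basis_vec_simps entry_def complex_eq_iff
  show "fst (to_lie x) $ 1 $ 1 = Complex 0 (2 * coframe 5 x / sqrt 3)"
    "fst (to_lie x) $ 1 $ 2 = Complex (- coframe 1 x) (coframe 2 x)"
    "fst (to_lie x) $ 1 $ 3 = Complex (coframe 3 x) (coframe 4 x)"
    "fst (to_lie x) $ 2 $ 1 = Complex (coframe 1 x) (coframe 2 x)"
    "fst (to_lie x) $ 2 $ 2 = Complex 0 (- coframe 5 x / sqrt 3)"
    "fst (to_lie x) $ 2 $ 3 = 0"
    "fst (to_lie x) $ 3 $ 1 = Complex (- coframe 3 x) (coframe 4 x)"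
    "fst (to_lie x) $ 3 $ 2 = 0"
    "fst (to_lie x) $ 3 $ 3 = Complex 0 (- coframe 5 x / sqrt 3)"
    "snd (to_lie x) $ 1 $ 1 = Complex 0 (- coframe 8 x / 2)"
    "snd (to_lie x) $ 1 $ 2 = Complex (- coframe 7 x / 2) (- coframe 6 x / 2)"
    "snd (to_lie x) $ 2 $ 1 = Complex (coframe 7 x / 2) (- coframe 6 x / 2)"
    "snd (to_lie x) $ 2 $ 2 = Complex 0 (coframe 8 x / 2)"
    unfolding x by simp_all
qed

lemma coframe_bracket_m:
  "i \<in> {1..8} \<Longrightarrow> coframe i (bracket_m x y) = coord i (bracket (to_lie x) (to_lie y))"
  unfolding bracket_m_def
  by (rule coframe_proj_m) (simp_all add: bracket_def su_commutator to_lie_su)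

text \<open>In the first four equations sqrt 3 = (2 + 1) / sqrt 3 is the eigenvalue gap of the fifth
  basis vector divided by i; the last three are the bracket of the second factor.\<close>

lemma structure_equations:
  "coframe 1 (bracket_m x y) = - sqrt 3 * minor coframe x y 2 5"
  "coframe 2 (bracket_m x y) = sqrt 3 * minor coframe x y 1 5"
  "coframe 3 (bracket_m x y) = sqrt 3 * minor coframe x y 4 5"
  "coframe 4 (bracket_m x y) = - sqrt 3 * minor coframe x y 3 5"
  "coframe 5 (bracket_m x y) = - sqrt 3 * minor coframe x y 1 2 + sqrt 3 * minor coframe x y 3 4"
  "coframe 6 (bracket_m x y) = minor coframe x y 7 8"
  "coframe 7 (bracket_m x y) = - minor coframe x y 6 8"
  "coframe 8 (bracket_m x y) = minor coframe x y 6 7"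
  by (simp_all add: coframe_bracket_m coord_simps bracket_def matrix_matrix_mult_def sum_3 sum_2
    to_lie_entries minor_def field_simps)

section \<open>The isotropy representation\<close>

lemma matrix_inv_eq:
  fixes A :: "complex^'n^'n"
  assumes "B ** A = mat 1" shows "matrix_inv A = B"
proof -
  have AB: "A ** B = mat 1" using assms by (simp add: matrix_left_right_inverse)
  have "A ** matrix_inv A = mat 1 \<and> matrix_inv A ** A = mat 1"
    unfolding matrix_inv_def by (rule someI[of _ B]) (use assms AB in simp)
  then show ?thesis
    using assms by (metis matrix_mul_assoc matrix_mul_lid matrix_mul_rid)
qed

text \<open>Unitarity turns the fixed first column into a trivial first row; the remaining block has
  the usual form of a matrix in SU(2).\<close>

lemma group_H_entries:
  assumes "(A, C) \<in> group_H"
  obtains p q where "cnj p * p + cnj q * q = 1" "A $ 1 $ 1 = 1" "A $ 2 $ 1 = 0" "A $ 3 $ 1 = 0"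
    "A $ 1 $ 2 = 0" "A $ 1 $ 3 = 0" "A $ 2 $ 2 = p" "A $ 3 $ 2 = q" "A $ 2 $ 3 = - cnj q"
    "A $ 3 $ 3 = cnj p" "adj A ** A = mat 1" "C = mat 1"
proof -
  have U: "adj A ** A = mat 1" and d: "det A = 1" and v: "A *v vector [1, 0, 0] = vector [1, 0, 0]"
    and C: "C = mat 1"
    using assms by (auto simp: group_H_def group_G_def SU_def)
  have col: "A $ 1 $ 1 = 1" "A $ 2 $ 1 = 0" "A $ 3 $ 1 = 0"
    using v by (simp_all add: vec_eq_iff forall_3 matrix_vector_mult_def sum_3)
  have dot: "cnj (A $ 1 $ i) * A $ 1 $ j + cnj (A $ 2 $ i) * A $ 2 $ j + cnj (A $ 3 $ i) * A $ 3 $ j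
      = (if i = j then 1 else 0)" for i j
    using arg_cong[OF U, of "\<lambda>M. M $ i $ j"] by (simp add: matrix_matrix_mult_def adj_def sum_3 mat_def)
  have row: "A $ 1 $ 2 = 0" "A $ 1 $ 3 = 0"
    using dot[of 1 2] dot[of 1 3] col by simp_all
  have pq: "cnj (A $ 2 $ 2) * A $ 2 $ 2 + cnj (A $ 3 $ 2) * A $ 3 $ 2 = 1"
    and ort: "cnj (A $ 2 $ 2) * A $ 2 $ 3 + cnj (A $ 3 $ 2) * A $ 3 $ 3 = 0"
    using dot[of 2 2] dot[of 2 3] row by simp_all
  have det: "A $ 2 $ 2 * A $ 3 $ 3 - A $ 2 $ 3 * A $ 3 $ 2 = 1"
    using d col row by (simp add: det_3)
  \<comment> \<open>For the first equation: multiply \<open>det\<close> by the conjugate of the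
    entry (2,2), substitute \<open>ort\<close>, and collect the entry (3,3) by \<open>pq\<close>.
    The second is similar.\<close>
  have "A $ 3 $ 3 = cnj (A $ 2 $ 2)" "A $ 2 $ 3 = - cnj (A $ 3 $ 2)"
    using pq ort det by algebra+
  then show ?thesis using that[of "A $ 2 $ 2" "A $ 3 $ 2"] pq col row U C by simp
qed

text \<open>With complex coordinates x1 + i x2 and -x3 + i x4, this is the standard representation
  of SU(2) on complex pairs, where p = \<alpha> + i \<beta> and q = \<gamma> + i \<delta>.\<close>

lemma isotropy_coframe:
  assumes "a \<in> group_H"
  obtains \<alpha> \<beta> \<gamma> \<delta> :: real where "\<alpha> * \<alpha> + \<beta> * \<beta> + \<gamma> * \<gamma> + \<delta> * \<delta> = 1"
    "\<And>x. coframe 1 (isotropy a x) = \<alpha> * coframe 1 x - \<beta> * coframe 2 x + \<gamma> * coframe 3 x - \<delta> * coframe 4 x"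
    "\<And>x. coframe 2 (isotropy a x) = \<beta> * coframe 1 x + \<alpha> * coframe 2 x - \<delta> * coframe 3 x - \<gamma> * coframe 4 x"
    "\<And>x. coframe 3 (isotropy a x) = - \<gamma> * coframe 1 x + \<delta> * coframe 2 x + \<alpha> * coframe 3 x - \<beta> * coframe 4 x"
    "\<And>x. coframe 4 (isotropy a x) = \<delta> * coframe 1 x + \<gamma> * coframe 2 x + \<beta> * coframe 3 x + \<alpha> * coframe 4 x"
    "\<And>x. coframe 5 (isotropy a x) = coframe 5 x" "\<And>x. coframe 6 (isotropy a x) = coframe 6 x"
    "\<And>x. coframe 7 (isotropy a x) = coframe 7 x" "\<And>x. coframe 8 (isotropy a x) = coframe 8 x"
proof -
  obtain A C where a: "a = (A, C)" by force
  obtain p q where pq: "cnj p * p + cnj q * q = 1" and A: "A $ 1 $ 1 = 1" "A $ 2 $ 1 = 0" "A $ 3 $ 1 = 0"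
    "A $ 1 $ 2 = 0" "A $ 1 $ 3 = 0" "A $ 2 $ 2 = p" "A $ 3 $ 2 = q" "A $ 2 $ 3 = - cnj q"
    "A $ 3 $ 3 = cnj p" and U: "adj A ** A = mat 1" and C: "C = mat 1"
    using group_H_entries[of A C] assms a by metis
  have inv: "matrix_inv A = adj A" "matrix_inv C = mat 1"
    using U by (auto intro: matrix_inv_eq simp: C)
  have Ad: "Ad a X = (A ** fst X ** adj A, snd X)" for X
    by (simp add: Ad_def a inv) (simp add: C)
  have su: "A ** fst (to_lie x) ** adj A \<in> su" for x
  proof -
    have "adj (A ** fst (to_lie x) ** adj A) = A ** (- fst (to_lie x)) ** adj A"
      using to_lie_su(1)[of x] by (simp add: adj_mult adj_adj su_def matrix_mul_assoc)
    also have "\<dots> = - (A ** fst (to_lie x) ** adj A)"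
      by (simp add: matrix_matrix_mult_def vec_eq_iff sum_negf)
    finally have "adj (A ** fst (to_lie x) ** adj A) = - (A ** fst (to_lie x) ** adj A)" .
    moreover have "trace (A ** fst (to_lie x) ** adj A) = trace (adj A ** (A ** fst (to_lie x)))"
      by (rule trace_mul_sym)
    ultimately show ?thesis
      using to_lie_su(1)[of x] by (simp add: su_def matrix_mul_assoc U)
  qed
  have iso: "coframe i (isotropy a x) = coord i (A ** fst (to_lie x) ** adj A, snd (to_lie x))"
    if "i \<in> {1..8}" for i x
    unfolding isotropy_def Ad by (rule coframe_proj_m) (use su to_lie_su that in simp_all)
  \<comment> \<open>The adjoint of A also fixes the first basis vector, so conjugation acts on the
    first column as multiplication by A.\<close>
  have e: "(A ** fst (to_lie x) ** adj A) $ i $ 1 = (\<Sum>k\<in>UNIV. A $ i $ k * fst (to_lie x) $ k $ 1)" for i x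
    by (simp add: matrix_matrix_mult_def sum_3 adj_def A)
  note iso' = iso coord_simps e sum_3 A to_lie_entries
  show ?thesis
  proof (rule that[of "Re p" "Im p" "Re q" "Im q"])
    show "Re p * Re p + Im p * Im p + Re q * Re q + Im q * Im q = 1"
      using arg_cong[OF pq, of Re] by simp
  qed (simp_all add: iso')
qed

section \<open>Invariant 2-forms as building blocks of the 4-form\<close>

lemma invariant_form_wedge:
  "invariant_form \<alpha> \<Longrightarrow> invariant_form \<beta> \<Longrightarrow> invariant_form (wedge p q \<alpha> \<beta>)"
  unfolding invariant_form_def wedge_def by simp

lemma invariant_form_add: "invariant_form \<alpha> \<Longrightarrow> invariant_form \<beta> \<Longrightarrow> invariant_form (\<lambda>v. \<alpha> v + \<beta> v)"
  and invariant_form_mult: "invariant_form \<alpha> \<Longrightarrow> invariant_form (\<lambda>v. c * \<alpha> v)"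
  unfolding invariant_form_def by simp_all

text \<open>These span the anti-self-dual 2-forms in the first four directions, on which this copy
  of SU(2) acts trivially.\<close>

lemma invariant_two_forms:
  "invariant_form (lincomb coframe [(1, [1,2]), (-1, [3,4])])"
  "invariant_form (lincomb coframe [(1, [1,3]), (1, [2,4])])"
  "invariant_form (lincomb coframe [(1, [1,4]), (-1, [2,3])])"
proof -
  have "lincomb coframe [(1, [1,2]), (-1, [3,4])] (\<lambda>i. isotropy a (v i)) = lincomb coframe [(1, [1,2]), (-1, [3,4])] v
    \<and> lincomb coframe [(1, [1,3]), (1, [2,4])] (\<lambda>i. isotropy a (v i)) = lincomb coframe [(1, [1,3]), (1, [2,4])] v
    \<and> lincomb coframe [(1, [1,4]), (-1, [2,3])] (\<lambda>i. isotropy a (v i)) = lincomb coframe [(1, [1,4]), (-1, [2,3])] v"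
    if a: "a \<in> group_H" for a v
  proof -
    obtain \<alpha> \<beta> \<gamma> \<delta> :: real where abcd: "\<alpha> * \<alpha> + \<beta> * \<beta> + \<gamma> * \<gamma> + \<delta> * \<delta> = 1"
      and iso: "\<And>x. coframe 1 (isotropy a x) = \<alpha> * coframe 1 x - \<beta> * coframe 2 x + \<gamma> * coframe 3 x - \<delta> * coframe 4 x"
      "\<And>x. coframe 2 (isotropy a x) = \<beta> * coframe 1 x + \<alpha> * coframe 2 x - \<delta> * coframe 3 x - \<gamma> * coframe 4 x"
      "\<And>x. coframe 3 (isotropy a x) = - \<gamma> * coframe 1 x + \<delta> * coframe 2 x + \<alpha> * coframe 3 x - \<beta> * coframe 4 x"
      "\<And>x. coframe 4 (isotropy a x) = \<delta> * coframe 1 x + \<gamma> * coframe 2 x + \<beta> * coframe 3 x + \<alpha> * coframe 4 x"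
      by (rule isotropy_coframe[OF a]) blast
    show ?thesis
      using abcd unfolding lincomb_Cons lincomb_Nil monomial_pair iso by algebra
  qed
  then show "invariant_form (lincomb coframe [(1, [1,2]), (-1, [3,4])])"
    "invariant_form (lincomb coframe [(1, [1,3]), (1, [2,4])])"
    "invariant_form (lincomb coframe [(1, [1,4]), (-1, [2,3])])"
    unfolding invariant_form_def by blast+
qed

lemma invariant_pair:
  assumes "i \<in> {5..8}" "j \<in> {5..8}" shows "invariant_form (lincomb coframe [(1, [i, j])])"
  unfolding invariant_form_def
proof (intro ballI allI)
  fix a v assume "a \<in> group_H"
  then obtain "\<And>x. coframe 5 (isotropy a x) = coframe 5 x" "\<And>x. coframe 6 (isotropy a x) = coframe 6 x"
    "\<And>x. coframe 7 (isotropy a x) = coframe 7 x" "\<And>x. coframe 8 (isotropy a x) = coframe 8 x"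
    by (rule isotropy_coframe) blast
  moreover have "i = 5 \<or> i = 6 \<or> i = 7 \<or> i = 8" "j = 5 \<or> j = 6 \<or> j = 7 \<or> j = 8"
    using assms by auto
  ultimately have "coframe i (isotropy a x) = coframe i x" "coframe j (isotropy a x) = coframe j x" for x
    by metis+
  then show "lincomb coframe [(1, [i, j])] (\<lambda>i. isotropy a (v i)) = lincomb coframe [(1, [i, j])] v"
    by (simp add: lincomb_Cons lincomb_Nil monomial_pair)
qed

text \<open>The 4-form is a polynomial in invariant 2-forms, with \<open>e_form [1,2,3,4]\<close>
  equal to -1/2 times the square of the first one; thus no 4-form has to be transformed.\<close>

lemma invariant_form_Phi: "invariant_form (Phi t1 t2 t3 t4 t5)"
proof -
  let ?w1 = "lincomb coframe [(1, [1,2]), (-1, [3,4])]"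
  let ?w2 = "lincomb coframe [(1, [1,3]), (1, [2,4])]"
  let ?w3 = "lincomb coframe [(1, [1,4]), (-1, [2,3])]"
  let ?e = "\<lambda>i j. lincomb coframe [(1, [i, j])]"
  let ?W = "wedge 2 2"
  have W: "?W (lincomb coframe L) (lincomb coframe M) = lincomb coframe (list_normal (list_wedge L M))"
    if "\<forall>(c, I)\<in>set L. length I = 2" "\<forall>(c, I)\<in>set M. length I = 2" for L M
    unfolding lincomb_normal by (rule wedge_lincomb[OF that])
  have "Phi t1 t2 t3 t4 t5 = (\<lambda>v. (- (t1^4 / 2)) * ?W ?w1 ?w1 v + (t1^2 * t2 * t3 * ?W ?w1 (?e 5 6) v
      + ((- (t1^2 * t4 * t5)) * ?W ?w1 (?e 7 8) v + (t1^2 * t2 * t4 * ?W ?w2 (?e 5 7) v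
      + (t1^2 * t3 * t5 * ?W ?w2 (?e 6 8) v + (t1^2 * t2 * t5 * ?W ?w3 (?e 5 8) v
      + ((- (t1^2 * t3 * t4)) * ?W ?w3 (?e 6 7) v + t2 * t3 * t4 * t5 * ?W (?e 5 6) (?e 7 8) v)))))))"
    by (simp add: W) (simp add: list_wedge_def list_normal_def lincomb_def Phi_def fun_eq_iff algebra_simps)
  then show ?thesis
    by (simp only:) (intro invariant_form_add invariant_form_mult invariant_form_wedge invariant_two_forms
      invariant_pair; simp)
qed

section \<open>The exterior derivative on monomials\<close>

lemma koszul_sum:
  fixes h :: "nat \<Rightarrow> nat \<Rightarrow> real"
  shows "(\<Sum>j\<le>4. \<Sum>i<j. h i j) = h 0 1 + (h 0 2 + h 1 2) + (h 0 3 + h 1 3 + h 2 3)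
    + (h 0 4 + h 1 4 + h 2 4 + h 3 4)"
  by (simp add: eval_nat_numeral One_nat_def atMost_Suc lessThan_Suc add_ac)

text \<open>Laplace expansion of a 5 by 5 determinant along the rows a, b. The minus sign comes from
  the positions 0 and 1 of these rows.\<close>

lemma monomial_laplace:
  assumes "linear (f b)" "linear (f p)" "linear (f q)" "linear (f r)"
  shows "(\<Sum>j\<le>4. \<Sum>i<j. (-1) ^ (i + j) * (minor f (v i) (v j) a b * monomial f [p, q, r] (omit i (omit j v))))
    = - monomial f [a, b, p, q, r] v"
  using assms unfolding koszul_sum
  by (subst monomial_Cons_eval)
    (auto simp: monomial_triple monomial_quadruple minor_def omit_def eval_nat_numeral One_nat_def lessThan_Suc algebra_simps)

lemma monomial_quadruple_case:
  assumes "linear (f j)" "linear (f k)" "linear (f l)"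
  shows "monomial f [i, j, k, l] (case_nat z w) =
    f i z * monomial f [j, k, l] w - f j z * monomial f [i, k, l] w
    + f k z * monomial f [i, j, l] w - f l z * monomial f [i, j, k] w"
  using assms
  by (simp add: monomial_quadruple monomial_triple eval_nat_numeral One_nat_def algebra_simps)

text \<open>The Leibniz rule d(f^i \<and> \<beta>) = df^i \<and> \<beta> - f^i \<and> d\<beta>,
  where \<open>D i\<close> lists the monomials of df^i.\<close>

fun deriv_list :: "(nat \<Rightarrow> (real \<times> nat list) list) \<Rightarrow> nat list \<Rightarrow> (real \<times> nat list) list" where
  "deriv_list D [] = []"
| "deriv_list D (i # I) = map (\<lambda>(c, P). (c, P @ I)) (D i) @ map (\<lambda>(c, K). (- c, i # K)) (deriv_list D I)"


text \<open>Passing one index takes two transpositions, so the signs cancel: 2-forms commute with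
  all forms.\<close>

lemma monomial_move_pair:
  assumes "length P = 2" shows "monomial f (I @ P @ J) = monomial f (P @ I @ J)"
proof (induction I)
  case (Cons i I)
  obtain a b where P: "P = [a, b]"
    using assms by (auto simp: length_Suc_conv numeral_2_eq_2)
  have "monomial f (i # I @ P @ J) = monomial f (i # a # b # I @ J)"
    using Cons[unfolded P append.simps] by (simp add: monomial.simps(2)[of f i] P)
  also have "\<dots> = (\<lambda>v. (-1) * monomial f (a # i # b # I @ J) v)"
    using monomial_swap[of f i a "b # I @ J"] by (simp add: fun_eq_iff)
  also have "monomial f (a # i # b # I @ J) = (\<lambda>v. (-1) * monomial f (a # b # i # I @ J) v)"
  proof -
    have "monomial f (i # b # I @ J) = (\<lambda>v. (-1) * monomial f (b # i # I @ J) v)"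
      using monomial_swap[of f i b "I @ J"] by (simp add: fun_eq_iff)
    then show ?thesis
      by (simp only: monomial.simps(2)[of f a] wedge_mult_right list.size)
  qed
  finally show ?case by (simp add: P)
qed simp

lemma ext_deriv_add: "ext_deriv k (\<lambda>v. \<alpha> v + \<beta> v) = (\<lambda>v. ext_deriv k \<alpha> v + ext_deriv k \<beta> v)"
  and ext_deriv_mult: "ext_deriv k (\<lambda>v. c * \<alpha> v) = (\<lambda>v. c * ext_deriv k \<alpha> v)"
  and ext_deriv_0: "ext_deriv k (\<lambda>v. 0) = (\<lambda>v. 0)"
  by (simp_all add: ext_deriv_def sum.distrib sum_distrib_left algebra_simps)

text \<open>The assumption \<open>bracket\<close> is the equation df^i(x, y) = - f^i([x, y]), which
  is why \<open>D\<close> carries signs opposite to the structure constants.\<close>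

locale structure_coframe =
  fixes f :: "nat \<Rightarrow> tangent \<Rightarrow> real" and D :: "nat \<Rightarrow> (real \<times> nat list) list"
  assumes lin: "i \<in> {1..8} \<Longrightarrow> linear (f i)"
    and pairs: "i \<in> {1..8} \<Longrightarrow> (c, P) \<in> set (D i) \<Longrightarrow> length P = 2 \<and> set P \<subseteq> {1..8}"
    and bracket: "i \<in> {1..8} \<Longrightarrow>
      f i (bracket_m x y) = - (\<Sum>(c, P)\<leftarrow>D i. c * minor f x y (P ! 0) (P ! 1))"
begin

text \<open>The terms of the Koszul sum in which f^i takes the bracket add up to the wedge of df^i
  with the other three factors, by \<open>monomial_laplace\<close> on each summand of
  \<open>D i\<close>.\<close>

lemma koszul_term:
  assumes i: "i \<in> {1..8}" and pqr: "p \<in> {1..8}" "q \<in> {1..8}" "r \<in> {1..8}"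
  shows "(\<Sum>n\<le>4. \<Sum>m<n. (-1) ^ (m + n) * (f i (bracket_m (v m) (v n)) * monomial f [p, q, r] (omit m (omit n v))))
    = lincomb f (map (\<lambda>x. (fst x, snd x @ [p, q, r])) (D i)) v"
proof -
  have "(\<Sum>n\<le>4. \<Sum>m<n. (-1) ^ (m + n) * (- (\<Sum>(c, P)\<leftarrow>M. c * minor f (v m) (v n) (P ! 0) (P ! 1))
      * monomial f [p, q, r] (omit m (omit n v)))) = lincomb f (map (\<lambda>x. (fst x, snd x @ [p, q, r])) M) v"
    if "\<forall>(c, P)\<in>set M. length P = 2 \<and> set P \<subseteq> {1..8}" for M
    using that
  proof (induction M)
    case (Cons x M)
    obtain c a b where x: "x = (c, [a, b])" and b: "b \<in> {1..8}"
      using Cons.prems by (cases x) (auto simp: length_Suc_conv numeral_2_eq_2)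
    have "(\<Sum>n\<le>4. \<Sum>m<n. (-1) ^ (m + n) * (- (\<Sum>(c, P)\<leftarrow>x # M. c * minor f (v m) (v n) (P ! 0) (P ! 1))
        * monomial f [p, q, r] (omit m (omit n v)))) =
      - c * (\<Sum>n\<le>4. \<Sum>m<n. (-1) ^ (m + n) * (minor f (v m) (v n) a b * monomial f [p, q, r] (omit m (omit n v))))
      + (\<Sum>n\<le>4. \<Sum>m<n. (-1) ^ (m + n) * (- (\<Sum>(c, P)\<leftarrow>M. c * minor f (v m) (v n) (P ! 0) (P ! 1))
        * monomial f [p, q, r] (omit m (omit n v))))"
      unfolding sum_distrib_left sum.distrib[symmetric]
      by (intro sum.cong refl) (simp add: x algebra_simps)
    also have "\<dots> = lincomb f (map (\<lambda>x. (fst x, snd x @ [p, q, r])) (x # M)) v"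
      unfolding monomial_laplace[of f, OF lin[OF b] lin[OF pqr(1)] lin[OF pqr(2)] lin[OF pqr(3)]]
      using Cons.IH Cons.prems by (simp add: x lincomb_Cons)
    finally show ?case .
  qed (simp add: lincomb_Nil)
  then show ?thesis
    using pairs[OF i] unfolding bracket[OF i] by blast
qed

lemma ext_deriv_monomial:
  assumes ijkl: "i \<in> {1..8}" "j \<in> {1..8}" "k \<in> {1..8}" "l \<in> {1..8}"
  shows "ext_deriv 4 (monomial f [i, j, k, l]) = lincomb f (deriv_list D [i, j, k, l])"
proof
  fix v
  let ?L = "\<lambda>s I J r. lincomb f (map (\<lambda>x. (s * fst x, I @ snd x @ J)) (D r)) v"
  \<comment> \<open>\<open>koszul_term\<close> leaves the pair from df^r in front, whereas the
    Leibniz rule puts it in the place of r.\<close>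
  have move: "?L s I J r = s * ?L 1 [] (I @ J) r" if "r \<in> {1..8}" for s I J r
  proof -
    have "lincomb f (map (\<lambda>x. (s * fst x, I @ snd x @ J)) M) v =
        s * lincomb f (map (\<lambda>x. (1 * fst x, [] @ snd x @ (I @ J))) M) v"
      if "\<forall>(c, P)\<in>set M. length P = 2 \<and> set P \<subseteq> {1..8}" for M
      using that
    proof (induction M)
      case (Cons x M)
      obtain c P where "x = (c, P)" by force
      with Cons monomial_move_pair[of P f I J] show ?case
        by (simp add: lincomb_Cons algebra_simps)
    qed (simp add: lincomb_Nil)
    then show ?thesis using pairs[OF that] by blast
  qed
  have "ext_deriv 4 (monomial f [i, j, k, l]) v =
      ?L 1 [] [j, k, l] i - ?L 1 [] [i, k, l] j + ?L 1 [] [i, j, l] k - ?L 1 [] [i, j, k] l"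
    unfolding mult_1 append_Nil
      koszul_term[OF ijkl(1) ijkl(2,3,4), symmetric] koszul_term[OF ijkl(2) ijkl(1,3,4), symmetric]
      koszul_term[OF ijkl(3) ijkl(1,2,4), symmetric] koszul_term[OF ijkl(4) ijkl(1,2,3), symmetric]
      sum_subtractf[symmetric] sum.distrib[symmetric] ext_deriv_def
      monomial_quadruple_case[OF lin[OF ijkl(2)] lin[OF ijkl(3)] lin[OF ijkl(4)]]
    by (intro sum.cong refl) (simp add: algebra_simps)
  also have "\<dots> = ?L 1 [] [j, k, l] i + ?L (-1) [i] [k, l] j + ?L 1 [i, j] [l] k + ?L (-1) [i, j, k] [] l"
    using move[OF ijkl(2), of "-1" "[i]" "[k, l]"] move[OF ijkl(3), of 1 "[i, j]" "[l]"]
      move[OF ijkl(4), of "-1" "[i, j, k]" "[]"] by simp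
  also have "\<dots> = lincomb f (deriv_list D [i, j, k, l]) v"
    by (simp add: lincomb_append case_prod_unfold comp_def)
  finally show "ext_deriv 4 (monomial f [i, j, k, l]) v = lincomb f (deriv_list D [i, j, k, l]) v" .
qed

lemma ext_deriv_lincomb:
  assumes "\<forall>(c, I)\<in>set L. length I = 4 \<and> set I \<subseteq> {1..8}"
  shows "ext_deriv 4 (lincomb f L) =
    lincomb f (concat (map (\<lambda>(c, I). map (\<lambda>(d, J). (c * d, J)) (deriv_list D I)) L))"
  using assms
proof (induction L)
  case (Cons x L)
  obtain c I where x: "x = (c, I)" by force
  have "length I = Suc (Suc (Suc (Suc 0)))" and sub: "set I \<subseteq> {1..8}"
    using Cons.prems x by auto
  then obtain i j k l where I: "I = [i, j, k, l]"
    by (auto simp: length_Suc_conv)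
  have "ext_deriv 4 (monomial f I) = lincomb f (deriv_list D I)"
    unfolding I by (rule ext_deriv_monomial) (use sub I in simp_all)
  moreover have "c * lincomb f M v = lincomb f (map (\<lambda>(d, J). (c * d, J)) M) v" for M v
    by (induction M) (auto simp: lincomb_Nil lincomb_Cons algebra_simps)
  ultimately show ?case
    using Cons x by (simp add: lincomb_Cons ext_deriv_add ext_deriv_mult lincomb_append)
qed (simp add: lincomb_Nil ext_deriv_0)

end

section \<open>The family of 4-forms\<close>

lemma (in dual_frame) dual_frame_scale:
  assumes "\<And>i. i \<in> {1..8} \<Longrightarrow> c i \<noteq> 0"
  shows "dual_frame (\<lambda>i x. c i * f i x) (\<lambda>i. inverse (c i) *\<^sub>R B i)"
proof (rule dual_frame.intro)
  show "linear (\<lambda>x. c i * f i x)" if "i \<in> {1..8}" for i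
    by (intro linear_mult_const_left lin that)
  show "c i * f i (inverse (c j) *\<^sub>R B j) = (if i = j then 1 else 0)" if "i \<in> {1..8}" "j \<in> {1..8}" for i j
    using that assms[of j] by (auto simp: linear_scale[OF lin] dual)
  show "x = (\<Sum>i=1..8. (c i * f i x) *\<^sub>R inverse (c i) *\<^sub>R B i)" for x
  proof -
    have "(\<Sum>i=1..8. (c i * f i x) *\<^sub>R inverse (c i) *\<^sub>R B i) = (\<Sum>i=1..8. f i x *\<^sub>R B i)"
      by (intro sum.cong refl) (simp add: assms)
    also have "\<dots> = x" by (rule expand[symmetric])
    finally show ?thesis by (rule sym)
  qed
qed

lemma monomial_scale: "monomial (\<lambda>i x. c i * f i x) I v = prod_list (map c I) * monomial f I v"
proof -
  have "monomial (\<lambda>i x. c i * f i x) I = (\<lambda>v. prod_list (map c I) * monomial f I v)"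
    by (induction I) (simp_all add: monomial.simps(2) wedge_mult_left wedge_mult_right mult.assoc)
  then show ?thesis by simp
qed

lemma monomial_single:
  fixes f :: "nat \<Rightarrow> 'v::real_vector \<Rightarrow> real"
  shows "monomial f [i] v = f i (v 0)"
  using monomial_Cons_eval[of "[]" f i v] by simp

lemma (in dual_frame) monomial_frame_eval:
  assumes "distinct I" "distinct K" "length I = length K" "set I \<subseteq> {1..8}" "set K \<subseteq> {1..8}"
    and "\<not> set K \<subseteq> set I"
  shows "monomial f I (\<lambda>i. B (K ! i)) = 0"
proof -
  obtain k where "k < length K" "K ! k \<notin> set I"
    using assms(6) by (auto simp: subset_iff in_set_conv_nth)
  then show ?thesis
    using assms nth_mem[of k K] by (intro monomial_eq_0[of k]) (auto simp: dual subset_iff)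
qed

locale diag_weights =
  fixes t1 t2 t3 t4 t5 :: real
  assumes pos: "t1 > 0" "t2 > 0" "t3 > 0" "t4 > 0" "t5 > 0"
begin

definition weight :: "nat \<Rightarrow> real" where
  "weight i = [t1, t1, t1, t1, t2, t3, t4, t5] ! (i - 1)"

lemma weight_simps:
  "weight 1 = t1" "weight 2 = t1" "weight 3 = t1" "weight 4 = t1"
  "weight 5 = t2" "weight 6 = t3" "weight 7 = t4" "weight 8 = t5"
  by (simp_all add: weight_def)

definition F :: "nat \<Rightarrow> tangent \<Rightarrow> real" where
  "F = (\<lambda>i x. weight i * coframe i x)"

definition E :: "nat \<Rightarrow> tangent" where
  "E = (\<lambda>i. inverse (weight i) *\<^sub>R frame i)"

sublocale dual_frame F E
  unfolding F_def E_def
  by (rule tangent.dual_frame_scale, erule indices8_cases) (use pos in \<open>simp_all add: weight_simps\<close>)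

lemma Phi_eq: "Phi t1 t2 t3 t4 t5 = model_form F"
  unfolding Phi_def model_form_def F_def monomial_scale
  by (simp add: weight_simps fun_eq_iff power2_eq_square power4_eq_xxxx algebra_simps)

lemma adapted: "adapted_coframe (Phi t1 t2 t3 t4 t5) F"
  unfolding adapted_coframe_def using coframe Phi_eq by simp

lemma diag_metric_eq: "diag_metric t1 t2 t3 t4 t5 = coframe_metric F"
proof -
  have "(\<Sum>i=1..4. h i) = h 1 + h 2 + h 3 + (h (4 :: nat) :: real)" for h
    by (simp add: One_nat_def eval_nat_numeral atLeastAtMostSuc_conv add_ac)
  then show ?thesis
    unfolding coframe_metric_def sum_indices8
    by (simp add: diag_metric_def F_def weight_simps fun_eq_iff power2_eq_square algebra_simps)
qed

lemma invariant_metric_diag: "invariant_metric (diag_metric t1 t2 t3 t4 t5)"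
  unfolding invariant_metric_def
proof (intro conjI ballI allI)
  show "inner_product (diag_metric t1 t2 t3 t4 t5)"
    unfolding diag_metric_eq by (rule inner_product_metric)
next
  fix a x y assume "a \<in> group_H"
  then obtain \<alpha> \<beta> \<gamma> \<delta> :: real where abcd: "\<alpha> * \<alpha> + \<beta> * \<beta> + \<gamma> * \<gamma> + \<delta> * \<delta> = 1"
    and iso: "\<And>x. coframe 1 (isotropy a x) = \<alpha> * coframe 1 x - \<beta> * coframe 2 x + \<gamma> * coframe 3 x - \<delta> * coframe 4 x"
    "\<And>x. coframe 2 (isotropy a x) = \<beta> * coframe 1 x + \<alpha> * coframe 2 x - \<delta> * coframe 3 x - \<gamma> * coframe 4 x"
    "\<And>x. coframe 3 (isotropy a x) = - \<gamma> * coframe 1 x + \<delta> * coframe 2 x + \<alpha> * coframe 3 x - \<beta> * coframe 4 x"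
    "\<And>x. coframe 4 (isotropy a x) = \<delta> * coframe 1 x + \<gamma> * coframe 2 x + \<beta> * coframe 3 x + \<alpha> * coframe 4 x"
    "\<And>x. coframe 5 (isotropy a x) = coframe 5 x" "\<And>x. coframe 6 (isotropy a x) = coframe 6 x"
    "\<And>x. coframe 7 (isotropy a x) = coframe 7 x" "\<And>x. coframe 8 (isotropy a x) = coframe 8 x"
    by (rule isotropy_coframe) blast
  show "diag_metric t1 t2 t3 t4 t5 (isotropy a x) (isotropy a y) = diag_metric t1 t2 t3 t4 t5 x y"
    using abcd unfolding diag_metric_eq coframe_metric_def sum_indices8 F_def weight_simps iso
    by algebra
qed

text \<open>Rescaling multiplies the coefficient of F^a \<and> F^b in dF^i by weight i / (weight a *
  weight b). The constants are the absolute values of the resulting coefficients; the signs are in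
  \<open>D\<close>.\<close>

definition c1 where "c1 = sqrt 3 / t2"
definition c5 where "c5 = sqrt 3 * t2 / t1^2"
definition c6 where "c6 = t3 / (t4 * t5)"
definition c7 where "c7 = t4 / (t3 * t5)"
definition c8 where "c8 = t5 / (t3 * t4)"

definition D :: "nat \<Rightarrow> (real \<times> nat list) list" where
  "D i = [[(c1, [2,5])], [(- c1, [1,5])], [(- c1, [4,5])], [(c1, [3,5])], [(c5, [1,2]), (- c5, [3,4])],
     [(- c6, [7,8])], [(c7, [6,8])], [(- c8, [6,7])]] ! (i - 1)"

lemma D_simps:
  "D 1 = [(c1, [2,5])]" "D 2 = [(- c1, [1,5])]" "D 3 = [(- c1, [4,5])]" "D 4 = [(c1, [3,5])]"
  "D 5 = [(c5, [1,2]), (- c5, [3,4])]" "D 6 = [(- c6, [7,8])]" "D 7 = [(c7, [6,8])]" "D 8 = [(- c8, [6,7])]"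
  by (simp_all add: D_def)

sublocale structure_coframe F D
proof
  show "F i (x + y) = F i x + F i y" if "i \<in> {1..8}" for i x y
    by (rule linear_add[OF lin[OF that]])
  show "F i (c *\<^sub>R x) = c *\<^sub>R F i x" if "i \<in> {1..8}" for i c x
    by (rule linear_scale[OF lin[OF that]])
  show "length P = 2 \<and> set P \<subseteq> {1..8}" if "i \<in> {1..8}" "(c, P) \<in> set (D i)" for i c P
    by (rule indices8_cases[OF that(1)]; use that(2) in \<open>auto simp: D_simps\<close>)
  show "F i (bracket_m x y) = - (\<Sum>(c, P)\<leftarrow>D i. c * minor F x y (P ! 0) (P ! 1))" if "i \<in> {1..8}" for i x y
    by (insert pos, rule indices8_cases[OF that])
      (simp_all add: D_simps F_def weight_simps structure_equations minor_def c1_def c5_def c6_def c7_def c8_def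
        power2_eq_square field_simps)
qed

text \<open>The coefficient -2 c5 arises because F^1256 and -F^3456 contribute -c5 each through
  dF^5; the terms with c6, c7 and c8 come from the second group factor.\<close>

definition dPhi_list :: "(real \<times> nat list) list" where
  "dPhi_list = [(- 2 * c5, [1,2,3,4,6]), (c6, [1,2,5,7,8]), (c5, [1,2,6,7,8]), (2 * c1, [1,3,5,6,7]),
     (- c7, [1,3,5,6,8]), (c8, [1,4,5,6,7]), (2 * c1, [1,4,5,6,8]), (- c8, [2,3,5,6,7]),
     (- 2 * c1, [2,3,5,6,8]), (2 * c1, [2,4,5,6,7]), (- c7, [2,4,5,6,8]), (- c6, [3,4,5,7,8]),
     (- c5, [3,4,6,7,8])]"

lemma ext_deriv_Phi: "ext_deriv 4 (Phi t1 t2 t3 t4 t5) = lincomb F dPhi_list"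
proof -
  have "ext_deriv 4 (Phi t1 t2 t3 t4 t5) = lincomb F (list_normal
      (concat (map (\<lambda>(c, I). map (\<lambda>(d, J). (c * d, J)) (deriv_list D I)) model_list)))"
    unfolding Phi_eq model_form_lincomb lincomb_normal
    by (rule ext_deriv_lincomb) (simp add: model_list_def)
  also have "\<dots> = lincomb F dPhi_list"
    by (simp add: model_list_def D_simps list_normal_def lincomb_def dPhi_list_def fun_eq_iff algebra_simps)
  finally show ?thesis .
qed

text \<open>The surviving terms miss the index 5 or the index 6, hence the two directions of the Lee
  form.\<close>

lemma wedge_star_dPhi:
  "wedge 3 4 (star (Phi t1 t2 t3 t4 t5) 5 (ext_deriv 4 (Phi t1 t2 t3 t4 t5))) (Phi t1 t2 t3 t4 t5) =
    lincomb F [(- 2 * (c6 + c7 + c8), [1,2,3,4,6,7,8]), (8 * c1 + 4 * c5, [1,2,3,4,5,7,8])]"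
proof -
  have "star (Phi t1 t2 t3 t4 t5) 5 (ext_deriv 4 (Phi t1 t2 t3 t4 t5)) = lincomb F (list_hodge dPhi_list)"
    unfolding ext_deriv_Phi by (rule star_lincomb[OF adapted]) (simp_all add: dPhi_list_def)
  then have "wedge 3 4 (star (Phi t1 t2 t3 t4 t5) 5 (ext_deriv 4 (Phi t1 t2 t3 t4 t5))) (Phi t1 t2 t3 t4 t5) =
      lincomb F (list_normal (list_wedge (list_hodge dPhi_list) model_list))"
    unfolding Phi_eq model_form_lincomb lincomb_normal
    by (simp add: wedge_lincomb model_list_def dPhi_list_def list_hodge_def complement_def)
  also have "\<dots> = lincomb F [(- 2 * (c6 + c7 + c8), [1,2,3,4,6,7,8]), (8 * c1 + 4 * c5, [1,2,3,4,5,7,8])]"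
    by (simp add: model_list_def dPhi_list_def list_hodge_def complement_def list_wedge_def list_normal_def
      lincomb_def fun_eq_iff algebra_simps)
  finally show ?thesis .
qed

text \<open>In the Hodge operator, 5 moves past 6, 7, 8 with sign -1 and 6 moves past 7, 8 with sign
  +1, so both coefficients end up with the same sign.\<close>

lemma lee_form_lincomb:
  "lee_form (Phi t1 t2 t3 t4 t5) = lincomb F [(- (2 / 7) * (c6 + c7 + c8), [5]), (- (1 / 7) * (8 * c1 + 4 * c5), [6])]"
proof -
  have "star (Phi t1 t2 t3 t4 t5) 7
      (lincomb F [(- 2 * (c6 + c7 + c8), [1,2,3,4,6,7,8]), (8 * c1 + 4 * c5, [1,2,3,4,5,7,8])]) =
    lincomb F (list_hodge [(- 2 * (c6 + c7 + c8), [1,2,3,4,6,7,8]), (8 * c1 + 4 * c5, [1,2,3,4,5,7,8])])"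
    by (rule star_lincomb[OF adapted]) simp_all
  then show ?thesis
    unfolding lee_form_def wedge_star_dPhi
    by (simp add: list_hodge_def complement_def lincomb_def fun_eq_iff algebra_simps)
qed

lemma coefficients_pos: "c1 > 0" "c5 > 0" "c6 > 0" "c7 > 0" "c8 > 0"
  using pos by (simp_all add: c1_def c5_def c6_def c7_def c8_def)

text \<open>The vectors dual to the first monomial isolate its coefficient, which is
  negative.\<close>

lemma not_balanced: "\<not> balanced (Phi t1 t2 t3 t4 t5)"
proof
  assume "balanced (Phi t1 t2 t3 t4 t5)"
  then have "lincomb F [(- 2 * (c6 + c7 + c8), [1,2,3,4,6,7,8]), (8 * c1 + 4 * c5, [1,2,3,4,5,7,8])]
      (\<lambda>i. E ([1,2,3,4,6,7,8] ! i)) = 0"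
    unfolding balanced_def wedge_star_dPhi by simp
  moreover have "monomial F [1,2,3,4,6,7,8] (\<lambda>i. E ([1,2,3,4,6,7,8] ! i)) = 1"
    by (rule monomial_frame) (auto simp: lin dual)
  moreover have "monomial F [1,2,3,4,5,7,8] (\<lambda>i. E ([1,2,3,4,6,7,8] ! i)) = 0"
    by (rule monomial_frame_eval) simp_all
  ultimately show False
    using coefficients_pos by (simp add: lincomb_Cons lincomb_Nil)
qed

text \<open>The coefficient of \<open>e\<^sup>1\<^sup>2\<^sup>3\<^sup>4\<^sup>5\<close> vanishes in \<open>d\<Phi>\<close>, but not in \<open>\<vartheta> \<and> \<Phi>\<close>.\<close>

lemma not_locally_conformal_parallel: "\<not> locally_conformal_parallel (Phi t1 t2 t3 t4 t5)"
proof
  let ?v = "\<lambda>i. E ([1,2,3,4,5] ! i)"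
  let ?L = "[(- (2 / 7) * (c6 + c7 + c8), [5]), (- (1 / 7) * (8 * c1 + 4 * c5), [6])]"
  assume "locally_conformal_parallel (Phi t1 t2 t3 t4 t5)"
  then have "lincomb F dPhi_list = wedge 1 4 (lincomb F ?L) (Phi t1 t2 t3 t4 t5)"
    unfolding locally_conformal_parallel_def ext_deriv_Phi lee_form_lincomb .
  also have "\<dots> = wedge 1 4 (lincomb F ?L) (lincomb F model_list)"
    unfolding Phi_eq model_form_lincomb ..
  also have "\<dots> = lincomb F (list_normal (list_wedge ?L model_list))"
    unfolding lincomb_normal by (rule wedge_lincomb) (simp_all add: model_list_def)
  finally have "lincomb F dPhi_list ?v = lincomb F (list_normal (list_wedge ?L model_list)) ?v"
    by simp
  moreover have "monomial F I ?v = 0"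
    if "distinct I" "length I = 5" "set I \<subseteq> {1..8}" "\<not> {1,2,3,4,5} \<subseteq> set I" for I
    using that by (intro monomial_frame_eval) simp_all
  moreover have "monomial F [1,2,3,4,5] ?v = 1"
    by (rule monomial_frame) (auto simp: lin dual)
  \<comment> \<open>The right-hand side reduces to the contribution of F^5 \<and> F^1234, which is
    -2/7 (c6 + c7 + c8) and so nonzero.\<close>
  ultimately show False
    using coefficients_pos
    by (simp add: dPhi_list_def model_list_def list_wedge_def list_normal_def lincomb_def)
qed

lemma lee_form_Phi:
  "lee_form (Phi t1 t2 t3 t4 t5) = (\<lambda>v. - (1 / 7) *
    (2 * t2 * (t3^2 + t4^2 + t5^2) / (t3 * t4 * t5) * e_form [5] v
     + 4 * sqrt 3 * t3 * (2 * t1^2 + t2^2) / (t1^2 * t2) * e_form [6] v))"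
proof
  fix v
  have "2 * (c6 + c7 + c8) * t2 = 2 * t2 * (t3^2 + t4^2 + t5^2) / (t3 * t4 * t5)"
    using pos by (simp add: c6_def c7_def c8_def field_simps power2_eq_square)
  moreover have "(8 * c1 + 4 * c5) * t3 = 4 * sqrt 3 * t3 * (2 * t1^2 + t2^2) / (t1^2 * t2)"
    using pos by (simp add: c1_def c5_def field_simps power2_eq_square)
  moreover have "lee_form (Phi t1 t2 t3 t4 t5) v =
      - (1 / 7) * (2 * (c6 + c7 + c8) * t2 * e_form [5] v + (8 * c1 + 4 * c5) * t3 * e_form [6] v)"
    unfolding lee_form_lincomb
    by (simp add: lincomb_Cons lincomb_Nil monomial_single F_def weight_simps algebra_simps)
  ultimately show "lee_form (Phi t1 t2 t3 t4 t5) v = - (1 / 7) *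
    (2 * t2 * (t3^2 + t4^2 + t5^2) / (t3 * t4 * t5) * e_form [5] v
     + 4 * sqrt 3 * t3 * (2 * t1^2 + t2^2) / (t1^2 * t2) * e_form [6] v)"
    by simp
qed

lemma is_form_Phi: "is_form 4 (Phi t1 t2 t3 t4 t5)"
  unfolding Phi_eq model_form_lincomb
  by (rule is_form_lincomb) (simp add: model_list_def lin)

end

theorem proposition7p15:
  fixes t1 t2 t3 t4 t5 :: real
  assumes "t1 > 0" and "t2 > 0" and "0 < t3" and "t3 \<le> t4" and "t4 \<le> t5"
  shows "invariant_Spin7_structure (Phi t1 t2 t3 t4 t5)
    \<and> invariant_metric (diag_metric t1 t2 t3 t4 t5)
    \<and> induced_metric (Phi t1 t2 t3 t4 t5) = diag_metric t1 t2 t3 t4 t5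
    \<and> mixed_type (Phi t1 t2 t3 t4 t5)
    \<and> lee_form (Phi t1 t2 t3 t4 t5) = (\<lambda>v. - (1 / 7) *
        (2 * t2 * (t3^2 + t4^2 + t5^2) / (t3 * t4 * t5) * e_form [5] v
         + 4 * sqrt 3 * t3 * (2 * t1^2 + t2^2) / (t1^2 * t2) * e_form [6] v))"
proof -
  interpret diag_weights t1 t2 t3 t4 t5
    using assms by unfold_locales simp_all
  show ?thesis
    unfolding invariant_Spin7_structure_def admissible_def mixed_type_def
    using is_form_Phi invariant_form_Phi adapted invariant_metric_diag induced_metric_eq[OF adapted]
      diag_metric_eq not_balanced not_locally_conformal_parallel lee_form_Phi
    by auto
qed

end
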